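(* Let $\mathcal{A}\subset\mathbb{Z}^2$ be a finite set whose convex hull $\Delta_{\mathcal{A}}$ is a polygon, and let $f\colon\mathcal{A}\to\mathbb{R}^2$ be an assignment of control points. The following are equivalent: <ul> <li>for every choice of positive weights $w\in\mathbb{R}^{\mathcal{A}}_{>}$, the toric Bézier patch $F_w\colon\Delta_{\mathcal{A}}\to\mathbb{R}^2$ is injective on all of $\Delta_{\mathcal{A}}$;</li> <li>$f$ is compatible.</li> </ul>
   Context: Let $\mathcal{A}\subset\mathbb{Z}^2$ be finite and write $\Delta_{\mathcal{A}}$ for its convex hull, a lattice polygon. Write it via its edge inequalities as $\Delta_{\mathcal{A}}=\{x\in\mathbb{R}^2 : h_i(x)\ge 0,\ i=1,\dots,\ell\}$. Here there is one $h_i$ for each edge, and $h_i(x,y)=a_ix+b_iy+c_i$ with integers $a_i,b_i,c_i$ and $\gcd(a_i,b_i)=1$. For $\mathbf{a}\in\mathcal{A}$ the toric Bernstein polynomial is $\beta_{\mathbf{a}}(x)=\prod_{i=1}^{\ell} h_i(x)^{h_i(\mathbf{a})}$. Given control points $f\colon\mathcal{A}\to\mathbb{R}^d$ and weights $w=(w_{\mathbf{a}})\in\mathbb{R}^{\mathcal{A}}_{>}$ (all $w_{\mathbf{a}}>0$), the toric Bézier patch is $$F_w(x)=\frac{\sum_{\mathbf{a}\in\mathcal{A}} w_{\mathbf{a}} f(\mathbf{a})\beta_{\mathbf{a}}(x)}{\sum_{\mathbf{a}\in\mathcal{A}} w_{\mathbf{a}}\beta_{\mathbf{a}}(x)},\qquad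 x\in\Delta_{\mathcal{A}}.$$ An affinely independent triple $p_0,p_1,p_2\in\mathbb{R}^2$ has orientation given by the sign of $\det(p_1-p_0,\,p_2-p_0)$; it is positively oriented if this determinant is positive. An assignment $f\colon\mathcal{A}\to\mathbb{R}^2$ is weakly compatible if both of the following hold: <ol> <li>There exist affinely independent $\mathbf{a}_0,\mathbf{a}_1,\mathbf{a}_2\in\mathcal{A}$ such that $f(\mathbf{a}_0),f(\mathbf{a}_1),f(\mathbf{a}_2)$ are affinely independent.</li> <li>For any affinely independent $\mathbf{a}'_0,\mathbf{a}'_1,\mathbf{a}'_2\in\mathcal{A}$ with the same orientation as $\mathbf{a}_0,\mathbf{a}_1,\mathbf{a}_2$: if $f(\mathbf{a}'_0),f(\mathbf{a}'_1),f(\mathbf{a}'_2)$ are affinely independent, then they have the same orientation as $f(\mathbf{a}_0),f(\mathbf{a}_1),f(\mathbf{a}_2)$.</li> </ol> The assignment $f$ is compatible if it is weakly compatible and no two distinct vertices of $\Delta_{\mathcal{A}}$ have the same image under $f$. *)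

theory Defs
  imports "HOL-Analysis.Analysis"
begin

definition rpt :: "int \<times> int \<Rightarrow> real \<times> real" where
  "rpt p = (of_int (fst p), of_int (snd p))"

definition Delta :: "(int \<times> int) set \<Rightarrow> (real \<times> real) set" where
  "Delta A = convex hull (rpt ` A)"

definition hval :: "int \<times> int \<times> int \<Rightarrow> real \<times> real \<Rightarrow> real" where
  "hval e x = (case e of (a, b, c) \<Rightarrow> of_int a * fst x + of_int b * snd x + of_int c)"

definition hint :: "int \<times> int \<times> int \<Rightarrow> int \<times> int \<Rightarrow> int" where
  "hint e p = (case e of (a, b, c) \<Rightarrow> a * fst p + b * snd p + c)"

text \<open>The edge inequalities of Delta_A: one triple (a,b,c) with gcd(a,b)=1 for each edge,
  with h \<ge> 0 on Delta_A and the edge equal to the zero set of h in Delta_A.\<close>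
definition edge_ineqs :: "(int \<times> int) set \<Rightarrow> (int \<times> int \<times> int) set" where
  "edge_ineqs A = {e. case e of (a, b, c) \<Rightarrow>
       gcd a b = 1 \<and> (\<forall>x\<in>Delta A. hval e x \<ge> 0) \<and>
       (\<exists>F. F face_of Delta A \<and> aff_dim F = 1 \<and> F = {x \<in> Delta A. hval e x = 0})}"

definition toric_bernstein :: "(int \<times> int) set \<Rightarrow> int \<times> int \<Rightarrow> real \<times> real \<Rightarrow> real" where
  "toric_bernstein A p x = (\<Prod>e\<in>edge_ineqs A. hval e x ^ nat (hint e p))"

definition toric_patch ::
  "(int \<times> int) set \<Rightarrow> (int \<times> int \<Rightarrow> real) \<Rightarrow> (int \<times> int \<Rightarrow> 'v::real_vector) \<Rightarrow> real \<times> real \<Rightarrow> 'v" where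
  "toric_patch A w f x =
     (1 / (\<Sum>p\<in>A. w p * toric_bernstein A p x)) *\<^sub>R
       (\<Sum>p\<in>A. (w p * toric_bernstein A p x) *\<^sub>R f p)"

definition det3 :: "real \<times> real \<Rightarrow> real \<times> real \<Rightarrow> real \<times> real \<Rightarrow> real" where
  "det3 p0 p1 p2 = (fst p1 - fst p0) * (snd p2 - snd p0) - (snd p1 - snd p0) * (fst p2 - fst p0)"

definition aff_indep3 :: "real \<times> real \<Rightarrow> real \<times> real \<Rightarrow> real \<times> real \<Rightarrow> bool" where
  "aff_indep3 p0 p1 p2 \<longleftrightarrow> distinct [p0, p1, p2] \<and> \<not> affine_dependent {p0, p1, p2}"

definition orientation :: "real \<times> real \<Rightarrow> real \<times> real \<Rightarrow> real \<times> real \<Rightarrow> real" where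
  "orientation p0 p1 p2 = sgn (det3 p0 p1 p2)"

definition weakly_compatible :: "(int \<times> int) set \<Rightarrow> (int \<times> int \<Rightarrow> real \<times> real) \<Rightarrow> bool" where
  "weakly_compatible A f \<longleftrightarrow>
     (\<exists>a0\<in>A. \<exists>a1\<in>A. \<exists>a2\<in>A.
        aff_indep3 (rpt a0) (rpt a1) (rpt a2) \<and> aff_indep3 (f a0) (f a1) (f a2) \<and>
        (\<forall>b0\<in>A. \<forall>b1\<in>A. \<forall>b2\<in>A.
           aff_indep3 (rpt b0) (rpt b1) (rpt b2) \<and>
           orientation (rpt b0) (rpt b1) (rpt b2) = orientation (rpt a0) (rpt a1) (rpt a2) \<and>
           aff_indep3 (f b0) (f b1) (f b2) \<longrightarrow>
           orientation (f b0) (f b1) (f b2) = orientation (f a0) (f a1) (f a2)))"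

definition compatible :: "(int \<times> int) set \<Rightarrow> (int \<times> int \<Rightarrow> real \<times> real) \<Rightarrow> bool" where
  "compatible A f \<longleftrightarrow> weakly_compatible A f \<and>
     (\<forall>u\<in>A. \<forall>v\<in>A. rpt u extreme_point_of Delta A \<and> rpt v extreme_point_of Delta A \<and> u \<noteq> v
        \<longrightarrow> f u \<noteq> f v)"

end

(* Put D(a,b,c) = det(a,b,c) det(f a, f b, f c). Weak compatibility says that D does not vanish
   identically and never takes both signs. By Cauchy-Binet, the sum of r_a r_b r_c D(a,b,c) is a
   multiple of the determinant of M_r = sum_a r_a (1, f a)(1, a)^T.

   If F_w(x) = F_w(y) with x <> y, the normalised Bernstein weights at x and at y differ by r_a L(a),
   where L is a nonzero affine form: ln h_i(x) - ln h_i(y) is the coefficient of h_i when x and y are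
   interior, and on the boundary the edges through x or y get large coefficients. Here r_a > 0 for
   every a in the support of a weight, and L can be chosen to vanish at one further control index b,
   for which r_b > 0 is then free. So L is in the kernel of M_r, all D(a,b,c) on these indices vanish,
   and this contradicts compatibility; on the boundary the distinctness of the vertex images enters.

   Conversely, if D takes both signs or vanishes identically, then M_r is singular for some r > 0.
   The map x |-> sum_i ln h_i(x) grad h_i is injective on the interior, hence open by invariance of
   domain, so a small multiple of a kernel form L arises from two interior points x and y, and
   weights with F_w(x) = F_w(y) can be read off. *)
theory Submission
  imports Defs
begin

section \<open>Integer edge forms and primitive normals of lattice lines\<close>

definition hgrad :: "int \<times> int \<times> int \<Rightarrow> real \<times> real" where
  "hgrad e = (of_int (fst e), of_int (fst (snd e)))"

lemma hval_eq_inner: "hval e x = hgrad e \<bullet> x + of_int (snd (snd e))"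
  by (auto simp: hval_def hgrad_def inner_prod_def split: prod.splits)

lemma hval_rpt: "hval e (rpt p) = of_int (hint e p)"
  by (auto simp: hval_def hint_def rpt_def split: prod.splits)

lemma hval_diff: "hval e x - hval e y = hgrad e \<bullet> (x - y)"
  by (simp add: hval_eq_inner inner_diff_right)

lemma hval_convex_comb:
  "hval e ((1 - u) *\<^sub>R x + u *\<^sub>R y) = (1 - u) * hval e x + u * hval e y"
  by (simp add: hval_eq_inner inner_add_right inner_scaleR_right algebra_simps)

lemma inj_rpt: "inj rpt"
  by (auto simp: inj_def rpt_def prod_eq_iff)

text \<open>Dividing \<open>q - p\<close> by the gcd of its coordinates and rotating by a quarter
  turn gives a primitive integer normal of the line. The real normal \<open>a\<close> is a multiple
  of it, and the sign of the multiple selects the side \<open>a \<bullet> x \<le> b\<close>.\<close>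

lemma lattice_half_plane:
  fixes a :: "real \<times> real"
  assumes "a \<noteq> 0" "p \<noteq> q" "a \<bullet> rpt p = b" "a \<bullet> rpt q = b"
  obtains e k where "gcd (fst e) (fst (snd e)) = 1" "k > 0" "\<And>x. hval e x = k * (b - a \<bullet> x)"
proof -
  define d1 where "d1 = fst q - fst p"
  define d2 where "d2 = snd q - snd p"
  define g where "g = gcd d1 d2"
  have d: "d1 \<noteq> 0 \<or> d2 \<noteq> 0" using assms(2) by (auto simp: d1_def d2_def prod_eq_iff)
  then have g0: "g \<noteq> 0" by (simp add: g_def)
  define n1 where "n1 = d1 div g"
  define n2 where "n2 = d2 div g"
  have n: "d1 = g * n1" "d2 = g * n2" by (auto simp: n1_def n2_def g_def)
  have gc: "gcd n1 n2 = 1"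
    unfolding n1_def n2_def g_def using div_gcd_coprime[OF d] by (simp only: coprime_iff_gcd_eq_1)
  obtain a1 a2 where a: "a = (a1, a2)" by (cases a)
  have "a1 * of_int d1 + a2 * of_int d2 = 0"
    using assms(3,4) by (simp add: a rpt_def d1_def d2_def algebra_simps)
  then have "of_int g * (a1 * of_int n1 + a2 * of_int n2) = 0"
    by (simp add: n algebra_simps)
  then have orth: "a1 * of_int n1 + a2 * of_int n2 = 0" using g0 by simp
  define N where "N = (of_int n1)\<^sup>2 + (of_int n2 :: real)\<^sup>2"
  have "n1 \<noteq> 0 \<or> n2 \<noteq> 0" using gc by auto
  then have N0: "N > 0" unfolding N_def
    by (metis of_int_eq_0_iff sum_power2_gt_zero_iff)
  \<comment> \<open>Since \<open>a\<close> is orthogonal to \<open>(n1, n2)\<close>, it equals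
    \<open>s\<close> times the rotated vector \<open>(n2, - n1)\<close>.\<close>
  define s where "s = (a1 * of_int n2 - a2 * of_int n1) / N"
  have "a1 * N = (a1 * of_int n2 - a2 * of_int n1) * of_int n2
      + (a1 * of_int n1 + a2 * of_int n2) * of_int n1"
    by (simp add: N_def power2_eq_square algebra_simps)
  then have a1: "a1 = s * of_int n2"
    using N0 by (simp add: s_def orth field_simps)
  have "a2 * N = - (a1 * of_int n2 - a2 * of_int n1) * of_int n1
      + (a1 * of_int n1 + a2 * of_int n2) * of_int n2"
    by (simp add: N_def power2_eq_square algebra_simps)
  then have a2: "a2 = - s * of_int n1"
    using N0 by (simp add: s_def orth field_simps)
  have s0: "s \<noteq> 0" using assms(1) a a1 a2 by (auto simp: zero_prod_def)
  define t :: int where "t = (if s > 0 then 1 else - 1)"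
  have ts: "of_int t / s > 0" using s0 by (auto simp: t_def field_simps)
  define e where "e = (- t * n2, t * n1, t * n2 * fst p - t * n1 * snd p)"
  have b: "b = s * (of_int n2 * of_int (fst p) - of_int n1 * of_int (snd p))"
    using assms(3) by (simp add: a rpt_def a1 a2 algebra_simps)
  show thesis
  proof (rule that[of e "of_int t / s"])
    show "gcd (fst e) (fst (snd e)) = 1"
      using gc by (auto simp: e_def t_def gcd.commute)
    show "hval e x = of_int t / s * (b - a \<bullet> x)" for x
      using s0 by (cases x) (simp add: hval_def e_def b a a1 a2 field_simps)
  qed (rule ts)
qed

section \<open>The polygon as the solution set of its edge inequalities\<close>

locale lattice_polygon =
  fixes A :: "(int \<times> int) set"
  assumes finA: "finite A" and dim2: "aff_dim (Delta A) = 2"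
begin

abbreviation "E \<equiv> edge_ineqs A"

lemma rpt_in_Delta: "p \<in> A \<Longrightarrow> rpt p \<in> Delta A"
  by (simp add: Delta_def hull_inc)

lemma polytope_Delta: "polytope (Delta A)"
  unfolding polytope_def Delta_def using finA by blast

lemma convex_Delta: "convex (Delta A)" and compact_Delta: "compact (Delta A)"
  using polytope_Delta polytope_imp_convex polytope_imp_compact by auto

lemma affine_hull_Delta: "affine hull (Delta A) = UNIV"
  using dim2 aff_dim_eq_full[of "Delta A"] by simp

lemma hval_nonneg: "e \<in> E \<Longrightarrow> x \<in> Delta A \<Longrightarrow> hval e x \<ge> 0"
  by (auto simp: edge_ineqs_def)

lemma hint_nonneg: "e \<in> E \<Longrightarrow> p \<in> A \<Longrightarrow> hint e p \<ge> 0"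
  using hval_nonneg[OF _ rpt_in_Delta, of e p] by (simp add: hval_rpt)

lemma hgrad_nonzero: "e \<in> E \<Longrightarrow> hgrad e \<noteq> 0"
  by (auto simp: edge_ineqs_def hgrad_def zero_prod_def)

lemma face_vertices:
  assumes "G face_of Delta A"
  shows "G = convex hull (rpt ` {p\<in>A. rpt p \<in> G})"
proof
  obtain S where S: "S \<subseteq> rpt ` A" "G = convex hull S"
    using face_of_convex_hull_subset[of "rpt ` A" G] assms finA
    by (metis Delta_def finite_imageI finite_imp_compact)
  then have "S \<subseteq> rpt ` {p\<in>A. rpt p \<in> G}" using hull_subset[of S convex] by blast
  then show "G \<subseteq> convex hull (rpt ` {p\<in>A. rpt p \<in> G})" using S(2) hull_mono by metis
  show "convex hull (rpt ` {p\<in>A. rpt p \<in> G}) \<subseteq> G"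
    by (rule hull_minimal) (use face_of_imp_convex[OF assms] convex_Delta in auto)
qed

lemma two_lattice_points_in_edge:
  assumes "G face_of Delta A" "aff_dim G = 1"
  obtains p q where "p \<in> A" "q \<in> A" "p \<noteq> q" "rpt p \<in> G" "rpt q \<in> G"
proof -
  let ?S = "{p\<in>A. rpt p \<in> G}"
  have "aff_dim (rpt ` ?S) = 1"
    using face_vertices[OF assms(1)] assms(2) aff_dim_convex_hull by metis
  then have "\<not> (\<exists>p. ?S \<subseteq> {p})"
    by (metis (no_types, lifting) aff_dim_empty aff_dim_sing image_empty image_insert
        minus_equation_iff one_neq_neg_one subset_singletonD zero_neq_one)
  moreover from this obtain p where "p \<in> ?S" by blast
  ultimately obtain q where "q \<in> ?S" "q \<noteq> p" by blast
  then show thesis using that \<open>p \<in> ?S\<close> by blast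
qed

text \<open>In a minimal representation by half-planes each half-plane cuts out a facet. A facet
  contains two lattice points, so its normal can be made primitive and its form belongs to
  \<open>E\<close>.\<close>

lemma Delta_eq_edge_ineqs: "Delta A = {x. \<forall>e\<in>E. hval e x \<ge> 0}"
proof (intro equalityI subsetI)
  fix x assume x: "x \<in> {x. \<forall>e\<in>E. hval e x \<ge> 0}"
  have "polyhedron (Delta A)" by (rule polytope_imp_polyhedron[OF polytope_Delta])
  then obtain F where F: "finite F" "Delta A = affine hull (Delta A) \<inter> \<Inter>F"
    and hF: "\<forall>h\<in>F. \<exists>a b. a \<noteq> 0 \<and> h = {x. a \<bullet> x \<le> b}"
    and minF: "\<And>F'. F' \<subset> F \<Longrightarrow> Delta A \<subset> affine hull (Delta A) \<inter> \<Inter>F'"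
    unfolding polyhedron_Int_affine_minimal by blast
  from bchoice[OF hF] obtain a where "\<forall>h\<in>F. \<exists>b. a h \<noteq> 0 \<and> h = {x. a h \<bullet> x \<le> b}"
    by (rule exE)
  from bchoice[OF this] obtain b where "\<forall>h\<in>F. a h \<noteq> 0 \<and> h = {x. a h \<bullet> x \<le> b h}"
    by (rule exE)
  then have ab: "\<And>h. h \<in> F \<Longrightarrow> a h \<noteq> 0 \<and> h = {x. a h \<bullet> x \<le> b h}" by (rule bspec)
  have "x \<in> h" if "h \<in> F" for h
  proof -
    let ?G = "Delta A \<inter> {x. a h \<bullet> x = b h}"
    have "?G facet_of Delta A"
      using facet_of_polyhedron_explicit[OF F ab minF] that by blast
    then have G: "?G face_of Delta A" "aff_dim ?G = 1"
      using dim2 by (auto simp: facet_of_def)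
    from two_lattice_points_in_edge[OF G] obtain p q where
      pq: "p \<noteq> q" "rpt p \<in> ?G" "rpt q \<in> ?G" by metis
    obtain e k where e: "gcd (fst e) (fst (snd e)) = 1" "k > 0"
      "\<And>x. hval e x = k * (b h - a h \<bullet> x)"
      by (rule lattice_half_plane[of "a h" p q "b h"]) (use ab[OF \<open>h \<in> F\<close>] pq in auto)
    have sub: "a h \<bullet> z \<le> b h" if "z \<in> Delta A" for z
      using that F(2) ab[OF \<open>h \<in> F\<close>] \<open>h \<in> F\<close> by blast
    have "?G = {x \<in> Delta A. hval e x = 0}"
      using e(2,3) by auto
    then have "e \<in> E"
      using e sub G by (cases e) (auto simp: edge_ineqs_def)
    then have "hval e x \<ge> 0" using x by blast
    then have "a h \<bullet> x \<le> b h" using e(2,3) by (simp add: zero_le_mult_iff)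
    then show "x \<in> h" using ab[OF that] by blast
  qed
  then show "x \<in> Delta A" using F(2) affine_hull_Delta by blast
qed (auto simp: hval_nonneg)

text \<open>Two integer forms with two common lattice zeros have proportional gradients, and
  primitivity leaves only equal or opposite forms. Opposite forms, both nonnegative on the polygon,
  would confine it to a line.\<close>

lemma edge_determines_ineq:
  assumes "e \<in> E" "e' \<in> E"
    and eq: "{x \<in> Delta A. hval e x = 0} = {x \<in> Delta A. hval e' x = 0}"
  shows "e = e'"
proof -
  obtain a b c where e: "e = (a, b, c)" by (cases e)
  obtain a' b' c' where e': "e' = (a', b', c')" by (cases e')
  from assms(1) obtain G where G: "G face_of Delta A" "aff_dim G = 1"
    and Geq: "G = {x \<in> Delta A. hval e x = 0}"
    by (auto simp: edge_ineqs_def)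
  from two_lattice_points_in_edge[OF G] obtain p q where
    pq: "p \<noteq> q" "rpt p \<in> G" "rpt q \<in> G" by metis
  obtain p1 p2 where p: "p = (p1, p2)" by (cases p)
  obtain q1 q2 where q: "q = (q1, q2)" by (cases q)
  have z: "hval e (rpt p) = 0" "hval e (rpt q) = 0" "hval e' (rpt p) = 0" "hval e' (rpt q) = 0"
    using pq Geq eq by blast+
  then have z: "a * p1 + b * p2 + c = 0" "a * q1 + b * q2 + c = 0"
      "a' * p1 + b' * p2 + c' = 0" "a' * q1 + b' * q2 + c' = 0"
    unfolding hval_rpt of_int_eq_0_iff by (simp_all add: hint_def e e' p q)
  have gc: "coprime a b" "coprime a' b'"
    using assms(1,2) by (auto simp: edge_ineqs_def e e' coprime_iff_gcd_eq_1)
  \<comment> \<open>By these identities the determinant of the two gradients, times either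
    coordinate of \<open>q - p\<close>, is a combination of values of the forms at \<open>p\<close>
    and \<open>q\<close>, all of which are zero.\<close>
  have "(a * b' - a' * b) * (q1 - p1) = b' * ((a * q1 + b * q2 + c) - (a * p1 + b * p2 + c))
      - b * ((a' * q1 + b' * q2 + c') - (a' * p1 + b' * p2 + c'))"
    "(a * b' - a' * b) * (q2 - p2) = a * ((a' * q1 + b' * q2 + c') - (a' * p1 + b' * p2 + c'))
      - a' * ((a * q1 + b * q2 + c) - (a * p1 + b * p2 + c))"
    by (simp_all add: algebra_simps)
  then have par: "a * b' = a' * b" using pq(1) z by (auto simp: p q)
  have ab: "abs a = abs a' \<and> abs b = abs b'"
  proof -
    have "a dvd a' * b" "a' dvd a * b'" "b dvd b' * a" "b' dvd b * a'"
      using par by (metis dvd_triv_left mult.commute)+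
    then have "a dvd a'" "a' dvd a" "b dvd b'" "b' dvd b"
      using gc by (auto simp: coprime_dvd_mult_left_iff coprime_commute)
    then show ?thesis by (auto intro: zdvd_antisym_abs)
  qed
  have cases: "a' = a \<and> b' = b \<or> a' = - a \<and> b' = - b"
  proof (cases "a = 0 \<or> b = 0")
    case True then show ?thesis using ab by (auto simp: abs_eq_iff)
  next
    case False then show ?thesis using ab par by (auto simp: abs_eq_iff)
  qed
  show ?thesis
  proof (cases "a' = a \<and> b' = b")
    case True then show ?thesis using z by (simp add: e e')
  next
    case False
    then have "a' = - a" "b' = - b" using cases by auto
    then have "c' = - c" using z by auto
    then have neg: "hval e' x = - hval e x" for x
      by (simp add: e e' hval_def \<open>a' = - a\<close> \<open>b' = - b\<close>)
    have "Delta A \<subseteq> {x. hgrad e \<bullet> x = - of_int c}"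
    proof
      fix x assume "x \<in> Delta A"
      then have "hval e x = 0" using assms(1,2) neg hval_nonneg[of e x] hval_nonneg[of e' x] by auto
      then show "x \<in> {x. hgrad e \<bullet> x = - of_int c}" by (simp add: hval_eq_inner e)
    qed
    then have "aff_dim (Delta A) \<le> aff_dim {x. hgrad e \<bullet> x = - of_int c}" by (rule aff_dim_subset)
    then show ?thesis using dim2 hgrad_nonzero[OF assms(1)] by simp
  qed
qed

text \<open>A polytope has finitely many faces, and an edge determines its form. An infinite
  \<open>E\<close> would give the product in \<open>toric_bernstein\<close> its default value
  1.\<close>

lemma finite_edge_ineqs: "finite E"
proof (rule inj_on_finite)
  show "inj_on (\<lambda>e. {x \<in> Delta A. hval e x = 0}) E"
    using edge_determines_ineq by (auto simp: inj_on_def)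
  show "(\<lambda>e. {x \<in> Delta A. hval e x = 0}) ` E \<subseteq> {G. G face_of Delta A}"
    by (auto simp: edge_ineqs_def)
  show "finite {G. G face_of Delta A}"
    by (rule finite_polytope_faces[OF polytope_Delta])
qed

text \<open>Otherwise every edge form is constant along the direction \<open>x - y\<close>, so a
  whole line lies in the polygon, against compactness.\<close>

lemma hval_determines_point:
  assumes "x \<in> Delta A" "\<And>e. e \<in> E \<Longrightarrow> hval e x = hval e y"
  shows "x = y"
proof (rule ccontr)
  assume ne: "x \<noteq> y"
  have orth: "hgrad e \<bullet> (x - y) = 0" if "e \<in> E" for e
    using assms(2)[OF that] hval_diff[of e x y] by simp
  have "x + t *\<^sub>R (x - y) \<in> Delta A" for t :: real
  proof -
    have "hval e (x + t *\<^sub>R (x - y)) = hval e x" if "e \<in> E" for e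
      using orth[OF that] by (simp add: hval_eq_inner inner_add_right)
    then show ?thesis using assms(1) by (simp add: Delta_eq_edge_ineqs)
  qed
  moreover obtain B where B: "\<And>z. z \<in> Delta A \<Longrightarrow> norm z \<le> B"
    using compact_imp_bounded[OF compact_Delta] by (auto simp: bounded_iff)
  ultimately have le: "norm (x + t *\<^sub>R (x - y)) \<le> B" for t by blast
  define t where "t = (B + norm x + 1) / norm (x - y)"
  have n0: "norm (x - y) > 0" using ne by simp
  have B0: "B \<ge> 0" using B[OF assms(1)] norm_ge_zero order_trans by blast
  have "norm (t *\<^sub>R (x - y)) = B + norm x + 1"
    using n0 B0 by (simp add: t_def)
  moreover have "norm (t *\<^sub>R (x - y)) \<le> norm (x + t *\<^sub>R (x - y)) + norm x"
    by (metis add.commute add_diff_cancel_left' norm_triangle_ineq4)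
  ultimately show False using le[of t] by linarith
qed

text \<open>From an interior point a short step against the gradient stays in the polygon and
  decreases the form strictly.\<close>

lemma hval_pos_interior:
  assumes "e \<in> E" "x \<in> interior (Delta A)"
  shows "hval e x > 0"
proof (rule ccontr)
  assume "\<not> hval e x > 0"
  then have le: "hval e x \<le> 0" by simp
  obtain d where d: "d > 0" "ball x d \<subseteq> Delta A"
    using assms(2) by (auto simp: mem_interior)
  define k where "k = d / (2 * norm (hgrad e))"
  have n0: "norm (hgrad e) > 0" using hgrad_nonzero[OF assms(1)] by simp
  then have k: "k > 0" using d by (simp add: k_def)
  have "x - k *\<^sub>R hgrad e \<in> ball x d"
    using n0 d(1) by (simp add: dist_norm k_def)
  then have "hval e (x - k *\<^sub>R hgrad e) \<ge> 0"
    using d hval_nonneg[OF assms(1)] by blast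
  moreover have "hval e (x - k *\<^sub>R hgrad e) = hval e x - k * (norm (hgrad e))\<^sup>2"
    by (simp add: hval_eq_inner inner_diff_right power2_norm_eq_inner)
  moreover have "k * (norm (hgrad e))\<^sup>2 > 0" using k n0 by simp
  ultimately show False using le by linarith
qed

section \<open>Carrier faces and the control indices active at a point\<close>

text \<open>For \<open>x\<close> in the polygon this is the smallest face containing
  \<open>x\<close>.\<close>

definition carrier_face :: "real \<times> real \<Rightarrow> (real \<times> real) set" where
  "carrier_face x = {z \<in> Delta A. \<forall>e\<in>E. hval e x = 0 \<longrightarrow> hval e z = 0}"

lemma carrier_face_face: "carrier_face x face_of Delta A"
  unfolding face_of_def
proof (intro conjI ballI impI)
  show "carrier_face x \<subseteq> Delta A" by (auto simp: carrier_face_def)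
  show "convex (carrier_face x)"
    unfolding convex_alt
    using convex_Delta[unfolded convex_alt] by (auto simp: carrier_face_def hval_convex_comb)
  fix a b z
  assume ab: "a \<in> Delta A" "b \<in> Delta A" and z: "z \<in> carrier_face x" "z \<in> open_segment a b"
  then obtain u where u: "0 < u" "u < 1" "z = (1 - u) *\<^sub>R a + u *\<^sub>R b"
    by (auto simp: in_segment)
  have "hval e a = 0 \<and> hval e b = 0" if "e \<in> E" "hval e x = 0" for e
  proof -
    have "(1 - u) * hval e a + u * hval e b = 0"
      using z(1) that u(3) by (simp add: carrier_face_def hval_convex_comb)
    moreover have "(1 - u) * hval e a \<ge> 0" "u * hval e b \<ge> 0"
      using u ab hval_nonneg[OF that(1)] by auto
    ultimately have "(1 - u) * hval e a = 0" "u * hval e b = 0" by linarith+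
    then show ?thesis using u by auto
  qed
  then show "a \<in> carrier_face x" "b \<in> carrier_face x"
    using ab by (auto simp: carrier_face_def)
qed

text \<open>For \<open>x\<close> in the polygon these are the indices whose Bernstein polynomial is
  nonzero at \<open>x\<close>, see \<open>bernstein_pos_iff\<close>.\<close>

definition supp :: "real \<times> real \<Rightarrow> (int \<times> int) set" where
  "supp x = {p \<in> A. rpt p \<in> carrier_face x}"

lemma supp_iff: "p \<in> supp x \<longleftrightarrow> p \<in> A \<and> (\<forall>e\<in>E. hval e x = 0 \<longrightarrow> hint e p = 0)"
  by (auto simp: supp_def carrier_face_def rpt_in_Delta hval_rpt)

lemma carrier_face_eq_hull: "carrier_face x = convex hull (rpt ` supp x)"
  using face_vertices[OF carrier_face_face, of x] by (simp add: supp_def)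

lemma in_hull_supp: "x \<in> Delta A \<Longrightarrow> x \<in> convex hull (rpt ` supp x)"
  using carrier_face_eq_hull[of x] by (auto simp: carrier_face_def)

lemma supp_nonempty: "x \<in> Delta A \<Longrightarrow> supp x \<noteq> {}"
  using in_hull_supp by fastforce

text \<open>Every edge form that vanishes at the vertex would also vanish at a second index
  \<open>p\<close> of the support. The segment from \<open>p\<close> to the vertex could then be
  prolonged beyond it inside the polygon.\<close>

lemma supp_vertex:
  assumes "rpt v extreme_point_of Delta A"
  shows "supp (rpt v) = {v}"
proof -
  have vA: "v \<in> A"
    using extreme_point_of_convex_hull[of "rpt v" "rpt ` A"] assms
    by (simp add: Delta_def inj_image_mem_iff[OF inj_rpt])
  have "p = v" if p: "p \<in> supp (rpt v)" for p
  proof (rule ccontr)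
    assume ne: "p \<noteq> v"
    let ?x = "rpt v"
    let ?z = "\<lambda>t. ?x - t *\<^sub>R (rpt p - ?x)"
    have hz: "hval e (?z t) = (1 + t) * hval e ?x - t * hval e (rpt p)" for e t
      by (simp add: hval_eq_inner inner_diff_right algebra_simps)
    have "\<exists>d>0. \<forall>t. 0 < t \<and> t \<le> d \<longrightarrow> hval e (?z t) \<ge> 0" if "e \<in> E" for e
    proof (cases "hval e ?x = 0")
      case True
      then have "hval e (rpt p) = 0" using p that by (simp add: supp_iff hval_rpt)
      then show ?thesis using True by (auto simp: hz intro: exI[of _ 1])
    next
      case False
      then have pos: "hval e ?x > 0" using hval_nonneg[OF that rpt_in_Delta[OF vA]] by simp
      have pp: "hval e (rpt p) \<ge> 0" using hval_nonneg[OF that rpt_in_Delta] p by (simp add: supp_iff)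
      show ?thesis
      proof (intro exI[of _ "hval e ?x / (1 + hval e (rpt p))"] conjI allI impI)
        show "hval e ?x / (1 + hval e (rpt p)) > 0" using pos pp by simp
        fix t assume t: "0 < t \<and> t \<le> hval e ?x / (1 + hval e (rpt p))"
        then have "t * (1 + hval e (rpt p)) \<le> hval e ?x" using pp by (simp add: pos_le_divide_eq)
        moreover have "0 \<le> t * hval e ?x" using t pos by simp
        ultimately show "hval e (?z t) \<ge> 0" unfolding hz using t by (simp add: algebra_simps)
      qed
    qed
    then obtain d where d: "\<And>e. e \<in> E \<Longrightarrow> d e > 0 \<and> (\<forall>t. 0 < t \<and> t \<le> d e \<longrightarrow> hval e (?z t) \<ge> 0)"
      by metis
    \<comment> \<open>A step length valid for all edges at once; the inserted 1 makes the minimum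
      defined even for an empty set of edges.\<close>
    define m where "m = Min (insert 1 (d ` E))"
    have m: "m > 0" "\<And>e. e \<in> E \<Longrightarrow> m \<le> d e"
      using d finite_edge_ineqs by (auto simp: m_def)
    then have "?z m \<in> Delta A" using d by (auto simp: Delta_eq_edge_ineqs)
    moreover have "rpt p \<in> Delta A" using p rpt_in_Delta by (simp add: supp_iff)
    moreover have "?x \<in> open_segment (rpt p) (?z m)"
    proof -
      have nep: "rpt p \<noteq> ?x" using ne by (simp add: inj_eq[OF inj_rpt])
      have "?x = (1 - 1 / (1 + m)) *\<^sub>R rpt p + (1 / (1 + m)) *\<^sub>R ?z m"
      proof -
        have "(1 - 1 / (1 + m)) = m / (1 + m)" using m by (simp add: field_simps)
        moreover have "?z m = (1 + m) *\<^sub>R ?x - m *\<^sub>R rpt p"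
          by (simp add: algebra_simps)
        moreover have "1 / (1 + m) + m / (1 + m) = 1" using m by (simp add: field_simps)
        then have "(1 / (1 + m)) *\<^sub>R ?x + (m / (1 + m)) *\<^sub>R ?x = ?x"
          by (simp only: scaleR_add_left[symmetric] scaleR_one)
        ultimately show ?thesis using m by (simp add: scaleR_diff_right scaleR_add_right)
      qed
      moreover have "rpt p \<noteq> ?z m"
      proof
        assume "rpt p = ?z m"
        then have "(1 + m) *\<^sub>R (rpt p - ?x) = 0" by (simp add: algebra_simps)
        then show False using m nep by simp
      qed
      ultimately show ?thesis using m unfolding in_segment
        by (intro conjI exI[of _ "1 / (1 + m)"]) auto
    qed
    ultimately show False using assms by (auto simp: extreme_point_of_def)
  qed
  moreover have "v \<in> supp (rpt v)" using vA by (auto simp: supp_iff hval_rpt)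
  ultimately show ?thesis by blast
qed

end

section \<open>Determinants of triples and the moment matrix\<close>

lemma det3_expand:
  "det3 p q s = (fst q * snd s - snd q * fst s) + (fst s * snd p - snd s * fst p)
     + (fst p * snd q - snd p * fst q)"
  by (simp add: det3_def algebra_simps)

lemma det3_cyclic: "det3 q s p = det3 p q s"
  by (simp add: det3_def algebra_simps)

lemma det3_swap: "det3 p s q = - det3 p q s"
  by (simp add: det3_def algebra_simps)

lemma det3_eq_0 [simp]: "det3 p p q = 0" "det3 p q p = 0" "det3 p q q = 0"
  by (simp_all add: det3_def algebra_simps)

text \<open>Multiplied by a coordinate of \<open>q - p\<close>, one of which is nonzero,
  \<open>det3 r s t\<close> is a combination of the three vanishing determinants.\<close>

lemma det3_trans:
  assumes "p \<noteq> q" "det3 p q r = 0" "det3 p q s = 0" "det3 p q t = 0"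
  shows "det3 r s t = 0"
proof -
  have "(fst q - fst p) * det3 r s t = (fst s - fst r) * (det3 p q t - det3 p q r)
      - (fst t - fst r) * (det3 p q s - det3 p q r)"
    "(snd q - snd p) * det3 r s t = (snd s - snd r) * (det3 p q t - det3 p q r)
      - (snd t - snd r) * (det3 p q s - det3 p q r)"
    by (simp_all add: det3_def algebra_simps)
  then show ?thesis using assms by (auto simp: prod_eq_iff)
qed

text \<open>\<open>det3\<close> is affine in its first argument, and affine functions are
  annihilated by coefficients with zero sum and zero moment.\<close>

lemma sum_det3_eq_0:
  fixes v :: "'i \<Rightarrow> real \<times> real"
  assumes "(\<Sum>i\<in>I. m i) = 0" "(\<Sum>i\<in>I. m i *\<^sub>R v i) = 0"
  shows "(\<Sum>i\<in>I. m i * det3 (v i) p q) = 0"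
proof -
  have "(\<Sum>i\<in>I. m i * fst (v i)) = 0" "(\<Sum>i\<in>I. m i * snd (v i)) = 0"
    using arg_cong[OF assms(2), of fst] arg_cong[OF assms(2), of snd]
    by (simp_all add: fst_sum snd_sum)
  moreover have "(\<Sum>i\<in>I. m i * det3 (v i) p q) = (\<Sum>i\<in>I. m i) * (fst p * snd q - snd p * fst q)
      + (\<Sum>i\<in>I. m i * fst (v i)) * (snd p - snd q) + (\<Sum>i\<in>I. m i * snd (v i)) * (fst q - fst p)"
    unfolding sum_distrib_right sum.distrib[symmetric]
    by (intro sum.cong refl) (simp add: det3_def algebra_simps)
  ultimately show ?thesis using assms(1) by simp
qed

lemma sum3_rotate:
  "(\<Sum>a\<in>I. \<Sum>b\<in>I. \<Sum>c\<in>I. F b c a) = (\<Sum>a\<in>I. \<Sum>b\<in>I. \<Sum>c\<in>I. F a b c)"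
proof -
  have "(\<Sum>a\<in>I. \<Sum>b\<in>I. \<Sum>c\<in>I. F b c a) = (\<Sum>b\<in>I. \<Sum>a\<in>I. \<Sum>c\<in>I. F b c a)"
    by (rule sum.swap)
  also have "\<dots> = (\<Sum>b\<in>I. \<Sum>c\<in>I. \<Sum>a\<in>I. F b c a)"
    by (intro sum.cong refl sum.swap)
  finally show ?thesis .
qed

lemma sum3_rotate':
  "(\<Sum>a\<in>I. \<Sum>b\<in>I. \<Sum>c\<in>I. F c a b) = (\<Sum>a\<in>I. \<Sum>b\<in>I. \<Sum>c\<in>I. F a b c)"
  using sum3_rotate[of "\<lambda>a b c. F c a b" I] by simp

text \<open>The product of the two determinants is invariant under permutations, so each unordered
  triple counts six times.\<close>

definition weighted_dets :: "'i set \<Rightarrow> ('i \<Rightarrow> real) \<Rightarrow> ('i \<Rightarrow> real \<times> real) \<Rightarrow> ('i \<Rightarrow> real \<times> real) \<Rightarrow> real"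
  where "weighted_dets I r u v =
    (\<Sum>a\<in>I. \<Sum>b\<in>I. \<Sum>c\<in>I. r a * r b * r c * (det3 (u a) (u b) (u c) * det3 (v a) (v b) (v c)))"

text \<open>The hypotheses say that \<open>(k, n)\<close> is a kernel vector of the matrix whose
  determinant is a sixth of \<open>weighted_dets\<close>. The proof multiplies
  \<open>weighted_dets\<close> by each coefficient of the form, one of which is nonzero.\<close>

lemma weighted_dets_eq_0:
  fixes u v :: "'i \<Rightarrow> real \<times> real"
  assumes nk: "n \<noteq> 0 \<or> k \<noteq> 0"
    and s0: "(\<Sum>i\<in>I. r i * (n \<bullet> u i + k)) = 0"
    and s1: "(\<Sum>i\<in>I. (r i * (n \<bullet> u i + k)) *\<^sub>R v i) = 0"
  shows "weighted_dets I r u v = 0"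
proof -
  let ?l = "\<lambda>i. n \<bullet> u i + k"
  \<comment> \<open>Summing over \<open>a\<close> first leaves the coefficients
    \<open>r a * ?l a\<close>, which have zero sum and zero moment, so the inner sum vanishes
    whatever \<open>g\<close> is.\<close>
  have z: "(\<Sum>a\<in>I. \<Sum>b\<in>I. \<Sum>c\<in>I. r a * r b * r c * (?l a * g b c * det3 (v a) (v b) (v c))) = 0" for g
  proof -
    have "(\<Sum>a\<in>I. \<Sum>b\<in>I. \<Sum>c\<in>I. r a * r b * r c * (?l a * g b c * det3 (v a) (v b) (v c)))
      = (\<Sum>b\<in>I. \<Sum>c\<in>I. \<Sum>a\<in>I. r a * r b * r c * (?l a * g b c * det3 (v a) (v b) (v c)))"
      by (rule sum3_rotate'[symmetric])
    also have "\<dots> = (\<Sum>b\<in>I. \<Sum>c\<in>I. r b * r c * g b c * (\<Sum>a\<in>I. r a * ?l a * det3 (v a) (v b) (v c)))"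
      by (intro sum.cong refl) (simp add: sum_distrib_left algebra_simps)
    also have "\<dots> = 0" by (simp add: sum_det3_eq_0[OF s0 s1])
    finally show ?thesis .
  qed
  \<comment> \<open>For each coefficient \<open>\<kappa>\<close> of the form, column operations turn \<open>\<kappa> * det3\<close> into a determinant
    with a column of values of the form.\<close>
  have "\<kappa> * weighted_dets I r u v = 0"
    if g: "\<And>a b c. \<kappa> * det3 (u a) (u b) (u c) = ?l a * g b c + ?l b * g c a + ?l c * g a b" for \<kappa> g
  proof -
    let ?F = "\<lambda>a b c. r a * r b * r c * (?l a * g b c * det3 (v a) (v b) (v c))"
    have "\<kappa> * (r a * r b * r c * (det3 (u a) (u b) (u c) * det3 (v a) (v b) (v c)))
       = ?F a b c + ?F b c a + ?F c a b" for a b c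
    proof -
      have "\<kappa> * (r a * r b * r c * (det3 (u a) (u b) (u c) * det3 (v a) (v b) (v c)))
        = r a * r b * r c * ((\<kappa> * det3 (u a) (u b) (u c)) * det3 (v a) (v b) (v c))" by simp
      also have "\<dots> = ?F a b c + ?F b c a + ?F c a b"
        unfolding g det3_cyclic[of "v a" "v b" "v c"] det3_cyclic[of "v b" "v c" "v a"]
        by (simp add: algebra_simps)
      finally show ?thesis .
    qed
    then have "\<kappa> * weighted_dets I r u v = (\<Sum>a\<in>I. \<Sum>b\<in>I. \<Sum>c\<in>I. ?F a b c)
       + (\<Sum>a\<in>I. \<Sum>b\<in>I. \<Sum>c\<in>I. ?F b c a) + (\<Sum>a\<in>I. \<Sum>b\<in>I. \<Sum>c\<in>I. ?F c a b)"
      by (simp only: weighted_dets_def sum_distrib_left sum.distrib)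
    also have "(\<Sum>a\<in>I. \<Sum>b\<in>I. \<Sum>c\<in>I. ?F b c a) = (\<Sum>a\<in>I. \<Sum>b\<in>I. \<Sum>c\<in>I. ?F a b c)"
      by (rule sum3_rotate)
    also have "(\<Sum>a\<in>I. \<Sum>b\<in>I. \<Sum>c\<in>I. ?F c a b) = (\<Sum>a\<in>I. \<Sum>b\<in>I. \<Sum>c\<in>I. ?F a b c)"
      by (rule sum3_rotate')
    finally show ?thesis using z by simp
  qed
  note key = this
  \<comment> \<open>In each case \<open>g\<close> gives the cofactors of the column replaced by
    values of the form: the column of ones for \<open>k\<close>, a coordinate column for a component
    of \<open>n\<close>.\<close>
  have "k * weighted_dets I r u v = 0"
    by (rule key[of _ "\<lambda>b c. fst (u b) * snd (u c) - snd (u b) * fst (u c)"])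
      (simp add: det3_def inner_prod_def algebra_simps)
  moreover have "fst n * weighted_dets I r u v = 0"
    by (rule key[of _ "\<lambda>b c. snd (u b) - snd (u c)"])
      (simp add: det3_def inner_prod_def algebra_simps)
  moreover have "snd n * weighted_dets I r u v = 0"
    by (rule key[of _ "\<lambda>b c. fst (u c) - fst (u b)"])
      (simp add: det3_def inner_prod_def algebra_simps)
  ultimately show ?thesis using nk by (auto simp: zero_prod_def prod_eq_iff)
qed

lemma sum3_product:
  fixes f g h :: "'i \<Rightarrow> real"
  shows "(\<Sum>a\<in>I. \<Sum>b\<in>I. \<Sum>c\<in>I. f a * g b * h c) = sum f I * sum g I * sum h I"
  by (simp only: sum_distrib_left[symmetric] sum_distrib_right[symmetric])

text \<open>The determinant of the \<open>3 \<times> 3\<close> matrix \<open>\<Sum>i\<in>I. r i (1, v i) (1, u i)\<^sup>T\<close>.\<close>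
definition moment_det :: "'i set \<Rightarrow> ('i \<Rightarrow> real) \<Rightarrow> ('i \<Rightarrow> real \<times> real) \<Rightarrow> ('i \<Rightarrow> real \<times> real) \<Rightarrow> real"
  where "moment_det I r u v =
    (\<Sum>i\<in>I. r i) * ((\<Sum>i\<in>I. r i * (fst (u i) * fst (v i))) * (\<Sum>i\<in>I. r i * (snd (u i) * snd (v i)))
        - (\<Sum>i\<in>I. r i * (snd (u i) * fst (v i))) * (\<Sum>i\<in>I. r i * (fst (u i) * snd (v i))))
    - (\<Sum>i\<in>I. r i * fst (u i)) * ((\<Sum>i\<in>I. r i * fst (v i)) * (\<Sum>i\<in>I. r i * (snd (u i) * snd (v i)))
        - (\<Sum>i\<in>I. r i * (snd (u i) * fst (v i))) * (\<Sum>i\<in>I. r i * snd (v i)))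
    + (\<Sum>i\<in>I. r i * snd (u i)) * ((\<Sum>i\<in>I. r i * fst (v i)) * (\<Sum>i\<in>I. r i * (fst (u i) * snd (v i)))
        - (\<Sum>i\<in>I. r i * (fst (u i) * fst (v i))) * (\<Sum>i\<in>I. r i * snd (v i)))"

text \<open>Cauchy-Binet, with a sum over ordered triples, hence the factor 6.\<close>
lemma weighted_dets_eq_moment_det: "weighted_dets I r u v = 6 * moment_det I r u v"
proof -
  let ?P = "\<lambda>a b c. r a * r b * r c * det3 (v a) (v b) (v c)"
  let ?S = "\<lambda>F. (\<Sum>a\<in>I. \<Sum>b\<in>I. \<Sum>c\<in>I. F a b c)"
  let ?g = "\<lambda>b c. fst (u b) * snd (u c) - snd (u b) * fst (u c)"
  let ?F = "\<lambda>a b c. ?P a b c * ?g b c"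
  let ?X = "?S (\<lambda>a b c. ?P a b c * (fst (u b) * snd (u c)))"
  have cyc: "det3 (v b) (v c) (v a) = det3 (v a) (v b) (v c)" for a b c
    by (rule det3_cyclic)
  \<comment> \<open>The determinant of the \<open>u\<close> points splits into three cyclic pairs of
    monomials. Rotating the indices identifies the pairs; swapping \<open>b\<close> and
    \<open>c\<close> flips the sign of the other determinant and identifies the two monomials of a
    pair. Six copies of \<open>?X\<close> remain.\<close>
  have "r a * r b * r c * (det3 (u a) (u b) (u c) * det3 (v a) (v b) (v c))
      = ?F a b c + ?F b c a + ?F c a b" for a b c
    using cyc[of b c a] cyc[of a b c] by (simp add: det3_expand[of "u a"] algebra_simps)
  then have "weighted_dets I r u v = ?S ?F + ?S (\<lambda>a b c. ?F b c a) + ?S (\<lambda>a b c. ?F c a b)"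
    by (simp only: weighted_dets_def sum.distrib)
  also have "?S (\<lambda>a b c. ?F b c a) = ?S ?F"
    by (rule sum3_rotate)
  also have "?S (\<lambda>a b c. ?F c a b) = ?S ?F"
    by (rule sum3_rotate')
  also have "?S ?F = ?X - ?S (\<lambda>a b c. ?P a b c * (snd (u b) * fst (u c)))"
    by (simp only: right_diff_distrib sum_subtractf)
  also have "?S (\<lambda>a b c. ?P a b c * (snd (u b) * fst (u c)))
      = ?S (\<lambda>a b c. ?P a c b * (snd (u c) * fst (u b)))"
    by (intro sum.cong refl sum.swap)
  also have "\<dots> = - ?X"
    unfolding sum_negf[symmetric]
    by (intro sum.cong refl) (simp add: det3_swap[of _ "v b" "v c" for b c] algebra_simps det3_def)
  finally have "weighted_dets I r u v = 6 * ?X" by simp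
  also have "?X = moment_det I r u v"
  proof -
    let ?T = "\<lambda>f g h. ?S (\<lambda>a b c. (r a * f a) * (r b * g b) * (r c * h c))"
    \<comment> \<open>Once the remaining determinant is expanded, every term is a product of
      functions of one index each, and the triple sums factor into moments.\<close>
    have "?X = ?S (\<lambda>a b c.
        (r a * 1) * (r b * (fst (u b) * fst (v b))) * (r c * (snd (u c) * snd (v c)))
      - (r a * 1) * (r b * (fst (u b) * snd (v b))) * (r c * (snd (u c) * fst (v c)))
      + (r a * snd (v a)) * (r b * fst (u b)) * (r c * (snd (u c) * fst (v c)))
      - (r a * fst (v a)) * (r b * fst (u b)) * (r c * (snd (u c) * snd (v c)))
      + (r a * fst (v a)) * (r b * (fst (u b) * snd (v b))) * (r c * snd (u c))
      - (r a * snd (v a)) * (r b * (fst (u b) * fst (v b))) * (r c * snd (u c)))"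
      by (intro sum.cong refl) (simp add: det3_def algebra_simps)
    then show ?thesis
      unfolding sum.distrib sum_subtractf sum3_product
      by (simp add: moment_det_def algebra_simps)
  qed
  finally show ?thesis .
qed

text \<open>A singular matrix has a nonzero kernel vector; its first entry is the constant
  \<open>k\<close> and the other two form \<open>n\<close>.\<close>

lemma moment_det_eq_0D:
  assumes "moment_det I r u v = 0"
  obtains n k where "n \<noteq> 0 \<or> k \<noteq> (0::real)"
    "(\<Sum>i\<in>I. r i * (n \<bullet> u i + k)) = 0" "(\<Sum>i\<in>I. (r i * (n \<bullet> u i + k)) *\<^sub>R v i) = 0"
proof -
  define M :: "real^3^3" where "M = vector
    [vector [\<Sum>i\<in>I. r i, \<Sum>i\<in>I. r i * fst (u i), \<Sum>i\<in>I. r i * snd (u i)],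
     vector [\<Sum>i\<in>I. r i * fst (v i), \<Sum>i\<in>I. r i * (fst (u i) * fst (v i)), \<Sum>i\<in>I. r i * (snd (u i) * fst (v i))],
     vector [\<Sum>i\<in>I. r i * snd (v i), \<Sum>i\<in>I. r i * (fst (u i) * snd (v i)), \<Sum>i\<in>I. r i * (snd (u i) * snd (v i))]]"
  have "det M = moment_det I r u v"
    by (simp add: det_3 M_def moment_det_def algebra_simps)
  with assms have "det M = 0" by simp
  then obtain l where l: "l \<noteq> 0" "M *v l = 0"
    using invertible_det_nz[of M] matrix_left_invertible_ker[of M] invertible_left_inverse[of M] by blast
  let ?n = "(l$2, l$3)" and ?k = "l$1"
  have "(M *v l) $ 1 = 0" "(M *v l) $ 2 = 0" "(M *v l) $ 3 = 0" using l(2) by simp_all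
  then have e: "(\<Sum>i\<in>I. r i) * l$1 + (\<Sum>i\<in>I. r i * fst (u i)) * l$2 + (\<Sum>i\<in>I. r i * snd (u i)) * l$3 = 0"
    "(\<Sum>i\<in>I. r i * fst (v i)) * l$1 + (\<Sum>i\<in>I. r i * (fst (u i) * fst (v i))) * l$2
       + (\<Sum>i\<in>I. r i * (snd (u i) * fst (v i))) * l$3 = 0"
    "(\<Sum>i\<in>I. r i * snd (v i)) * l$1 + (\<Sum>i\<in>I. r i * (fst (u i) * snd (v i))) * l$2
       + (\<Sum>i\<in>I. r i * (snd (u i) * snd (v i))) * l$3 = 0"
    by (simp_all add: matrix_vector_mult_def sum_3 M_def forall_3)
  show thesis
  proof (rule that[of ?n ?k])
    show "?n \<noteq> 0 \<or> ?k \<noteq> 0"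
      using l(1) by (auto simp: vec_eq_iff forall_3 zero_prod_def)
    show "(\<Sum>i\<in>I. r i * (?n \<bullet> u i + ?k)) = 0"
      using e(1) by (simp add: inner_prod_def algebra_simps sum_distrib_left sum.distrib)
    show "(\<Sum>i\<in>I. (r i * (?n \<bullet> u i + ?k)) *\<^sub>R v i) = 0"
    proof (rule prod_eqI)
      show "fst (\<Sum>i\<in>I. (r i * (?n \<bullet> u i + ?k)) *\<^sub>R v i) = fst 0"
        using e(2) by (simp add: fst_sum inner_prod_def algebra_simps sum_distrib_left sum.distrib)
      show "snd (\<Sum>i\<in>I. (r i * (?n \<bullet> u i + ?k)) *\<^sub>R v i) = snd 0"
        using e(3) by (simp add: snd_sum inner_prod_def algebra_simps sum_distrib_left sum.distrib)
    qed
  qed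
qed

section \<open>From the sign of weighted sums to the signs of single determinant products\<close>

text \<open>Under indicator weights only the six orderings of the triple survive, because a repeated
  index makes \<open>det3\<close> zero.\<close>

lemma weighted_dets_triple:
  assumes "finite I" "a \<in> I" "b \<in> I" "c \<in> I" "distinct [a, b, c]"
  shows "weighted_dets I (\<lambda>i. if i \<in> {a, b, c} then 1 else 0) u v
    = 6 * (det3 (u a) (u b) (u c) * det3 (v a) (v b) (v c))"
proof -
  let ?r = "\<lambda>i. if i \<in> {a, b, c} then 1 else (0::real)"
  let ?D = "\<lambda>a b c. det3 (u a) (u b) (u c) * det3 (v a) (v b) (v c)"
  have s: "(\<Sum>i\<in>I. ?r i * F i) = F a + F b + F c" for F
  proof -
    have "(\<Sum>i\<in>I. ?r i * F i) = (\<Sum>i\<in>{a, b, c}. F i)"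
      using assms by (intro sum.mono_neutral_cong_right) auto
    then show ?thesis using assms(5) by (simp add: add.assoc)
  qed
  have "weighted_dets I ?r u v = (\<Sum>i\<in>I. ?r i * (\<Sum>j\<in>I. ?r j * (\<Sum>k\<in>I. ?r k * ?D i j k)))"
    unfolding weighted_dets_def by (simp only: sum_distrib_left mult.assoc)
  also have "\<dots> = ?D a b c + ?D a c b + ?D b a c + ?D b c a + ?D c a b + ?D c b a"
    unfolding s by simp
  also have "\<dots> = 6 * ?D a b c"
    by (simp add: det3_def algebra_simps)
  finally show ?thesis .
qed

text \<open>Positive weights form a connected set, so a continuous function without zeros there has
  one sign. Indicator weights of triples are limits of positive weights and inherit the sign in weak
  form.\<close>

lemma weighted_dets_same_sign_or_zero:
  fixes u v :: "'i \<Rightarrow> real \<times> real"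
  assumes "finite I" and nz: "\<And>r. (\<And>i. i \<in> I \<Longrightarrow> r i > 0) \<Longrightarrow> weighted_dets I r u v \<noteq> 0"
  shows "(\<exists>a\<in>I. \<exists>b\<in>I. \<exists>c\<in>I. det3 (u a) (u b) (u c) * det3 (v a) (v b) (v c) \<noteq> 0) \<and>
    (\<exists>s\<in>{1, -1}. \<forall>a\<in>I. \<forall>b\<in>I. \<forall>c\<in>I. s * (det3 (u a) (u b) (u c) * det3 (v a) (v b) (v c)) \<ge> 0)"
proof
  let ?D = "\<lambda>a b c. det3 (u a) (u b) (u c) * det3 (v a) (v b) (v c)"
  let ?W = "\<lambda>r. weighted_dets I r u v"
  have W1: "?W (\<lambda>_. 1) \<noteq> 0" by (rule nz) simp
  show "\<exists>a\<in>I. \<exists>b\<in>I. \<exists>c\<in>I. ?D a b c \<noteq> 0"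
  proof (rule ccontr)
    assume "\<not> ?thesis"
    then have "?W (\<lambda>_. 1) = 0"
      unfolding weighted_dets_def by (intro sum.neutral ballI) auto
    with W1 show False by simp
  qed
  define s where "s = sgn (?W (\<lambda>_. 1))"
  have s: "s \<in> {1, -1}" "s * ?W (\<lambda>_. 1) > 0" using W1 by (auto simp: s_def sgn_if)
  have cont: "continuous_on T (\<lambda>t. s * ?W (\<lambda>i. (1 - t) * p i + t))" for p :: "'i \<Rightarrow> real" and T
    unfolding weighted_dets_def by (intro continuous_intros)
  \<comment> \<open>For positive parameters the segment from \<open>p\<close> to the constant weight
    1 consists of positive weights, so a change of sign would produce a forbidden zero.\<close>
  have pos: "s * ?W (\<lambda>i. (1 - t) * p i + t) > 0"
    if p: "\<And>i. p i \<ge> 0" and t: "0 < t" "t \<le> 1" for p :: "'i \<Rightarrow> real" and t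
  proof (rule ccontr)
    assume "\<not> ?thesis"
    then have "s * ?W (\<lambda>i. (1 - t) * p i + t) \<le> 0" by simp
    moreover have "s * ?W (\<lambda>i. (1 - 1) * p i + 1) \<ge> 0" using s(2) by simp
    ultimately obtain x where x: "t \<le> x" "x \<le> 1" "s * ?W (\<lambda>i. (1 - x) * p i + x) = 0"
      using IVT'[of "\<lambda>t. s * ?W (\<lambda>i. (1 - t) * p i + t)" t 0 1] t(2) cont by blast
    have "?W (\<lambda>i. (1 - x) * p i + x) \<noteq> 0"
    proof (rule nz)
      fix i
      have "(1 - x) * p i \<ge> 0" using p x by simp
      then show "(1 - x) * p i + x > 0" using x t by linarith
    qed
    with x(3) s(1) show False by auto
  qed
  have "s * ?D a b c \<ge> 0" if abc: "a \<in> I" "b \<in> I" "c \<in> I" for a b c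
  proof (cases "distinct [a, b, c]")
    case False
    then have "?D a b c = 0" by auto
    then show ?thesis by auto
  next
    case True
    let ?r = "\<lambda>i. if i \<in> {a, b, c} then 1 else (0::real)"
    have "((\<lambda>t. s * ?W (\<lambda>i. (1 - t) * ?r i + t)) \<longlongrightarrow> s * ?W (\<lambda>i. (1 - 0) * ?r i + 0)) (at_right 0)"
      using bspec[OF cont[of UNIV ?r, unfolded continuous_on_def] UNIV_I[of 0]]
      unfolding filterlim_at_split by (rule conjunct2)
    then have "s * ?W (\<lambda>i. (1 - 0) * ?r i + 0) \<ge> 0"
    proof (rule tendsto_lowerbound)
      show "\<forall>\<^sub>F t in at_right 0. 0 \<le> s * ?W (\<lambda>i. (1 - t) * ?r i + t)"
        unfolding eventually_at_right_field
        using pos[of ?r] by (intro exI[of _ 1]) (auto intro: less_imp_le)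
    qed simp
    then have "s * ?W ?r \<ge> 0" by simp
    then show ?thesis
      using weighted_dets_triple[OF assms(1) abc True, of u v] by (simp add: zero_le_mult_iff)
  qed
  then show "\<exists>s\<in>{1, -1}. \<forall>a\<in>I. \<forall>b\<in>I. \<forall>c\<in>I. s * ?D a b c \<ge> 0" using s(1) by blast
qed

section \<open>Weak compatibility as a common sign of determinant products\<close>

lemma aff_indep3_iff: "aff_indep3 p q s \<longleftrightarrow> det3 p q s \<noteq> 0"
proof -
  have "collinear {p, q, s} \<longleftrightarrow> det3 p q s = 0"
  proof
    assume "collinear {p, q, s}"
    then obtain w where w: "\<And>x y. x \<in> {p, q, s} \<Longrightarrow> y \<in> {p, q, s} \<Longrightarrow> \<exists>c. x - y = c *\<^sub>R w"
      unfolding collinear_def by blast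
    obtain c d where "q - p = c *\<^sub>R w" "s - p = d *\<^sub>R w"
      using w[of q p] w[of s p] by auto
    then have "q = p + c *\<^sub>R w" "s = p + d *\<^sub>R w" by (simp_all add: algebra_simps)
    then show "det3 p q s = 0" by (simp add: det3_def)
  next
    assume d: "det3 p q s = 0"
    show "collinear {p, q, s}"
    proof (cases "q = p")
      case True then show ?thesis by simp
    next
      case False
      define a where "a = q - p"
      define b where "b = s - p"
      have a0: "a \<noteq> 0" using False by (simp add: a_def)
      have ab: "fst a * snd b = snd a * fst b" using d by (simp add: det3_def a_def b_def)
      \<comment> \<open>The coefficient of the orthogonal projection of \<open>b\<close> onto
        \<open>a\<close>; parallel vectors make \<open>b\<close> equal to its projection.\<close>
      define t where "t = (a \<bullet> b) / (a \<bullet> a)"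
      have aa: "a \<bullet> a > 0" using a0 by simp
      have "(a \<bullet> a) *\<^sub>R b = (a \<bullet> b) *\<^sub>R a"
      proof (rule prod_eqI)
        show "fst ((a \<bullet> a) *\<^sub>R b) = fst ((a \<bullet> b) *\<^sub>R a)"
          using ab by (simp add: inner_prod_def) algebra
        show "snd ((a \<bullet> a) *\<^sub>R b) = snd ((a \<bullet> b) *\<^sub>R a)"
          using ab by (simp add: inner_prod_def) algebra
      qed
      then have "b = t *\<^sub>R a"
        using aa unfolding t_def by (simp add: eq_vector_fraction_iff)
      then have "s = p + t *\<^sub>R (q - p)" by (simp add: a_def b_def algebra_simps)
      then have "s = (1 - t) *\<^sub>R p + (1 - (1 - t)) *\<^sub>R q" by (simp add: algebra_simps)
      then have "collinear {p, s, q}" unfolding collinear_3_expand by blast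
      then show ?thesis by (simp add: insert_commute)
    qed
  qed
  then show ?thesis
    by (auto simp: aff_indep3_def collinear_3_eq_affine_dependent)
qed

text \<open>As the products do not depend on the order of the triple, one sign \<open>s\<close>
  replaces the reference triple and its orientation.\<close>

definition same_sign_dets :: "(int \<times> int) set \<Rightarrow> (int \<times> int \<Rightarrow> real \<times> real) \<Rightarrow> bool" where
  "same_sign_dets A f \<longleftrightarrow>
    (\<exists>a\<in>A. \<exists>b\<in>A. \<exists>c\<in>A. det3 (rpt a) (rpt b) (rpt c) * det3 (f a) (f b) (f c) \<noteq> 0) \<and>
    (\<exists>s\<in>{1, -1}. \<forall>a\<in>A. \<forall>b\<in>A. \<forall>c\<in>A.
       s * (det3 (rpt a) (rpt b) (rpt c) * det3 (f a) (f b) (f c)) \<ge> 0)"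

text \<open>A triple oriented against the reference triple is compared with it after a swap of two
  points, which reverses both determinants.\<close>

lemma weakly_compatible_iff_same_sign: "weakly_compatible A f \<longleftrightarrow> same_sign_dets A f"
proof
  let ?u = "\<lambda>a b c. det3 (rpt a) (rpt b) (rpt c)" and ?v = "\<lambda>a b c. det3 (f a) (f b) (f c)"
  {
    assume "weakly_compatible A f"
    then obtain a0 a1 a2 where a: "a0 \<in> A" "a1 \<in> A" "a2 \<in> A" "?u a0 a1 a2 \<noteq> 0" "?v a0 a1 a2 \<noteq> 0"
      and same: "\<And>b0 b1 b2. b0 \<in> A \<Longrightarrow> b1 \<in> A \<Longrightarrow> b2 \<in> A \<Longrightarrow> ?u b0 b1 b2 \<noteq> 0 \<Longrightarrow>
        sgn (?u b0 b1 b2) = sgn (?u a0 a1 a2) \<Longrightarrow> ?v b0 b1 b2 \<noteq> 0 \<Longrightarrow>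
        sgn (?v b0 b1 b2) = sgn (?v a0 a1 a2)"
      unfolding weakly_compatible_def aff_indep3_iff orientation_def by blast
    define s where "s = sgn (?u a0 a1 a2 * ?v a0 a1 a2)"
    have "s * (?u b0 b1 b2 * ?v b0 b1 b2) \<ge> 0" if b: "b0 \<in> A" "b1 \<in> A" "b2 \<in> A" for b0 b1 b2
    proof (cases "?u b0 b1 b2 = 0 \<or> ?v b0 b1 b2 = 0")
      case True then show ?thesis by auto
    next
      case False
      have "sgn (?u b0 b1 b2) = sgn (?u a0 a1 a2) \<or> sgn (?u b0 b1 b2) = - sgn (?u a0 a1 a2)"
        using False a(4) by (auto simp: sgn_if)
      then have "sgn (?u b0 b1 b2 * ?v b0 b1 b2) = s"
      proof
        assume eq: "sgn (?u b0 b1 b2) = sgn (?u a0 a1 a2)"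
        with same[OF b] False show ?thesis by (simp add: s_def sgn_mult)
      next
        assume eq: "sgn (?u b0 b1 b2) = - sgn (?u a0 a1 a2)"
        with same[OF b(1,3,2)] False have "sgn (?v b0 b1 b2) = - sgn (?v a0 a1 a2)"
          by (simp add: det3_swap[of _ "rpt b2" "rpt b1"] det3_swap[of _ "f b2" "f b1"] sgn_minus)
        with eq show ?thesis by (simp add: s_def sgn_mult)
      qed
      then have "s * (?u b0 b1 b2 * ?v b0 b1 b2) = \<bar>?u b0 b1 b2 * ?v b0 b1 b2\<bar>"
        by (metis abs_sgn mult.commute)
      then show ?thesis by simp
    qed
    moreover have "s \<in> {1, -1}" using a(4,5) by (auto simp: s_def sgn_if)
    ultimately show "same_sign_dets A f"
      unfolding same_sign_dets_def using a by (metis no_zero_divisors)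
  next
    assume "same_sign_dets A f"
    then obtain a0 a1 a2 s where a: "a0 \<in> A" "a1 \<in> A" "a2 \<in> A" "?u a0 a1 a2 * ?v a0 a1 a2 \<noteq> 0"
      and s: "s \<in> {1, -1}"
        "\<And>a b c. a \<in> A \<Longrightarrow> b \<in> A \<Longrightarrow> c \<in> A \<Longrightarrow> s * (?u a b c * ?v a b c) \<ge> 0"
      unfolding same_sign_dets_def by blast
    have *: "sgn (?u b c d) * sgn (?v b c d) = s"
      if "b \<in> A" "c \<in> A" "d \<in> A" "?u b c d * ?v b c d \<noteq> 0" for b c d
    proof -
      have "sgn (?u b c d * ?v b c d) = s"
        using s(1) s(2)[OF that(1-3)] that(4) by (auto simp: sgn_if)
      then show ?thesis by (simp add: sgn_mult)
    qed
    have "sgn (?v b c d) = sgn (?v a0 a1 a2)"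
      if "b \<in> A" "c \<in> A" "d \<in> A" "?u b c d \<noteq> 0" "sgn (?u b c d) = sgn (?u a0 a1 a2)" "?v b c d \<noteq> 0"
      for b c d
      using *[OF that(1-3)] *[OF a] that(4-6) by (metis mult_cancel_left no_zero_divisors sgn_0_0)
    then show "weakly_compatible A f"
      unfolding weakly_compatible_def aff_indep3_iff orientation_def
      using a by (metis mult_zero_left mult_zero_right)
  }
qed

text \<open>Times \<open>s\<close>, all terms are nonnegative, so a zero total makes each term zero,
  and positive weights cancel.\<close>

lemma weighted_dets_zero_terms:
  fixes u v :: "'i \<Rightarrow> real \<times> real"
  assumes fin: "finite I" and w: "weighted_dets I r u v = 0"
    and r: "\<And>i. i \<in> I \<Longrightarrow> r i \<ge> 0"
    and s: "s \<in> {1, -1}"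
      "\<And>a b c. a \<in> I \<Longrightarrow> b \<in> I \<Longrightarrow> c \<in> I \<Longrightarrow> s * (det3 (u a) (u b) (u c) * det3 (v a) (v b) (v c)) \<ge> 0"
    and abc: "a \<in> I" "b \<in> I" "c \<in> I" "r a > 0" "r b > 0" "r c > 0"
  shows "det3 (u a) (u b) (u c) * det3 (v a) (v b) (v c) = 0"
proof -
  let ?T = "\<lambda>a b c. r a * r b * r c * (s * (det3 (u a) (u b) (u c) * det3 (v a) (v b) (v c)))"
  have nn: "?T a b c \<ge> 0" if "a \<in> I" "b \<in> I" "c \<in> I" for a b c
    using that by (intro mult_nonneg_nonneg r s(2))
  have "(\<Sum>a\<in>I. \<Sum>b\<in>I. \<Sum>c\<in>I. ?T a b c) = s * weighted_dets I r u v"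
    unfolding weighted_dets_def sum_distrib_left by (intro sum.cong refl) simp
  then have "(\<Sum>a\<in>I. \<Sum>b\<in>I. \<Sum>c\<in>I. ?T a b c) = 0" using w by simp
  moreover have "(\<Sum>b\<in>I. \<Sum>c\<in>I. ?T x b c) \<ge> 0" if "x \<in> I" for x
    using that by (intro sum_nonneg nn)
  ultimately have "(\<Sum>b\<in>I. \<Sum>c\<in>I. ?T a b c) = 0"
    using sum_nonneg_0[OF fin _ _ abc(1), of "\<lambda>a. \<Sum>b\<in>I. \<Sum>c\<in>I. ?T a b c"] by blast
  moreover have "(\<Sum>c\<in>I. ?T a x c) \<ge> 0" if "x \<in> I" for x
    using that abc(1) by (intro sum_nonneg nn)
  ultimately have "(\<Sum>c\<in>I. ?T a b c) = 0"
    using sum_nonneg_0[OF fin _ _ abc(2), of "\<lambda>b. \<Sum>c\<in>I. ?T a b c"] by blast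
  moreover have "?T a b x \<ge> 0" if "x \<in> I" for x
    using that abc(1,2) by (intro nn)
  ultimately have "?T a b c = 0"
    using sum_nonneg_0[OF fin _ _ abc(3), of "\<lambda>c. ?T a b c"] by blast
  then show ?thesis using abc s(1) by auto
qed

lemma ln_diff_mult_diff:
  fixes s t :: real
  assumes "s > 0" "t > 0"
  shows "(ln s - ln t) * (s - t) \<ge> 0" "(ln s - ln t) * (s - t) = 0 \<longleftrightarrow> s = t"
  using assms by (cases s t rule: linorder_cases; simp add: mult_nonpos_nonpos)+

section \<open>Bernstein polynomials in logarithmic form and separating affine forms\<close>

context lattice_polygon
begin

text \<open>Edges through \<open>x\<close> contribute nothing, since \<open>ln 0 = 0\<close>.\<close>
definition log_form :: "real \<times> real \<Rightarrow> real \<times> real \<Rightarrow> real" where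
  "log_form x z = (\<Sum>e\<in>E. ln (hval e x) * hval e z)"

text \<open>On the support an edge through \<open>x\<close> has exponent 0, and
  \<open>0 ^ 0 = 1\<close> agrees with \<open>exp 0\<close>. Off the support some factor is a
  positive power of 0.\<close>

lemma bernstein_eq:
  assumes "x \<in> Delta A" "p \<in> A"
  shows "toric_bernstein A p x = (if p \<in> supp x then exp (log_form x (rpt p)) else 0)"
proof (cases "p \<in> supp x")
  case True
  have "hval e x ^ nat (hint e p) = exp (ln (hval e x) * hval e (rpt p))" if e: "e \<in> E" for e
  proof (cases "hval e x = 0")
    case z: True
    then have "hint e p = 0" using True e by (simp add: supp_iff)
    then show ?thesis using z by simp
  next
    case False
    then have pos: "hval e x > 0" using hval_nonneg[OF e assms(1)] by simp
    have "hval e (rpt p) = real (nat (hint e p))"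
      using hint_nonneg[OF e assms(2)] by (simp add: hval_rpt)
    then have "exp (ln (hval e x) * hval e (rpt p)) = exp (ln (hval e x)) ^ nat (hint e p)"
      by (simp only: exp_of_nat2_mult)
    then show ?thesis using pos by simp
  qed
  then show ?thesis using True finite_edge_ineqs
    by (simp add: toric_bernstein_def log_form_def exp_sum)
next
  case False
  then obtain e where e: "e \<in> E" "hval e x = 0" "hint e p \<noteq> 0"
    using assms(2) by (auto simp: supp_iff)
  then have "hval e x ^ nat (hint e p) = 0"
    using hint_nonneg[OF e(1) assms(2)] by (simp add: zero_power)
  then show ?thesis using False e(1) finite_edge_ineqs
    by (auto simp: toric_bernstein_def)
qed

lemma bernstein_pos_iff: "x \<in> Delta A \<Longrightarrow> p \<in> A \<Longrightarrow> toric_bernstein A p x > 0 \<longleftrightarrow> p \<in> supp x"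
  by (simp add: bernstein_eq)

lemma patch_denominator_pos:
  assumes "x \<in> Delta A" "\<And>p. p \<in> A \<Longrightarrow> w p > 0"
  shows "(\<Sum>p\<in>A. w p * toric_bernstein A p x) > 0"
proof -
  obtain p where p: "p \<in> supp x" using supp_nonempty[OF assms(1)] by blast
  then have pA: "p \<in> A" by (simp add: supp_iff)
  show ?thesis
  proof (rule sum_pos2[OF finA pA])
    show "0 < w p * toric_bernstein A p x"
      using assms pA p by (simp add: bernstein_eq)
    show "0 \<le> w i * toric_bernstein A i x" if "i \<in> A" for i
      using assms that by (simp add: bernstein_eq less_imp_le)
  qed
qed

text \<open>The form is \<open>log_form x - log_form y + c + \<alpha> H y - \<beta> H x\<close>, where \<open>H x\<close> is the sum of the edge
  forms vanishing at \<open>x\<close> and \<open>\<alpha>\<close>, \<open>\<beta>\<close> are large; two free parameters leave room for a zero at \<open>b\<close>.\<close>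
lemma separating_affine_form:
  assumes x: "x \<in> Delta A" and y: "y \<in> Delta A" and ne: "x \<noteq> y" and b: "b \<in> A"
  obtains n k where "n \<noteq> 0"
    "\<And>p. p \<in> supp x \<Longrightarrow> p \<in> supp y \<Longrightarrow> n \<bullet> rpt p + k = log_form x (rpt p) - log_form y (rpt p) + c"
    "\<And>p. p \<in> supp x \<Longrightarrow> p \<notin> supp y \<Longrightarrow> n \<bullet> rpt p + k > 0"
    "\<And>p. p \<in> supp y \<Longrightarrow> p \<notin> supp x \<Longrightarrow> n \<bullet> rpt p + k < 0"
    "b \<notin> supp x \<Longrightarrow> b \<notin> supp y \<Longrightarrow> n \<bullet> rpt b + k = 0"
proof -
  define K where "K z = log_form x z - log_form y z + c" for z
  define H where "H x z = (\<Sum>e\<in>E. if hval e x = 0 then hval e z else 0)" for x z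
  have H0: "H x (rpt p) = 0" if "p \<in> supp x" for x p
    using that by (auto simp: H_def supp_iff hval_rpt intro!: sum.neutral)
  \<comment> \<open>Integrality gives the bound: a nonnegative integer that is not zero is at least
    1.\<close>
  have H1: "H x (rpt p) \<ge> 1" if "p \<in> A" "p \<notin> supp x" for x p
  proof -
    obtain e where e: "e \<in> E" "hval e x = 0" "hint e p \<noteq> 0"
      using \<open>p \<notin> supp x\<close> \<open>p \<in> A\<close> by (auto simp: supp_iff)
    then have "hint e p \<ge> 1" using hint_nonneg[OF e(1) that(1)] by simp
    then have "1 \<le> (if hval e x = 0 then hval e (rpt p) else 0)"
      using e(2) by (simp add: hval_rpt)
    also have "\<dots> \<le> H x (rpt p)"
      unfolding H_def using finite_edge_ineqs e(1) hval_nonneg[OF _ rpt_in_Delta[OF that(1)]]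
      by (intro member_le_sum) auto
    finally show ?thesis .
  qed
  \<comment> \<open>\<open>m\<close> exceeds every \<open>\<bar>K (rpt p)\<bar>\<close> and every
    logarithm involved, so coefficients of size at least \<open>m\<close> decide the signs.\<close>
  define m where "m = 1 + (\<Sum>p\<in>A. \<bar>K (rpt p)\<bar>) + (\<Sum>e\<in>E. \<bar>ln (hval e x)\<bar>) + (\<Sum>e\<in>E. \<bar>ln (hval e y)\<bar>)"
  have nn: "(\<Sum>p\<in>A. \<bar>K (rpt p)\<bar>) \<ge> 0" "(\<Sum>e\<in>E. \<bar>ln (hval e x)\<bar>) \<ge> 0"
    "(\<Sum>e\<in>E. \<bar>ln (hval e y)\<bar>) \<ge> 0"
    by (simp_all add: sum_nonneg)
  have mK: "\<bar>K (rpt p)\<bar> < m" if "p \<in> A" for p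
  proof -
    have "\<bar>K (rpt p)\<bar> \<le> (\<Sum>p\<in>A. \<bar>K (rpt p)\<bar>)"
      using that finA by (intro member_le_sum) auto
    then show ?thesis using nn unfolding m_def by linarith
  qed
  have mx: "\<bar>ln (hval e x)\<bar> < m" and my: "\<bar>ln (hval e y)\<bar> < m" if "e \<in> E" for e
  proof -
    have "\<bar>ln (hval e x)\<bar> \<le> (\<Sum>e\<in>E. \<bar>ln (hval e x)\<bar>)" "\<bar>ln (hval e y)\<bar> \<le> (\<Sum>e\<in>E. \<bar>ln (hval e y)\<bar>)"
      using that finite_edge_ineqs by (auto intro: member_le_sum)
    then show "\<bar>ln (hval e x)\<bar> < m" "\<bar>ln (hval e y)\<bar> < m"
      using nn unfolding m_def by linarith+
  qed
  have m0: "m > 0" using mK[OF b] by linarith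
  obtain \<alpha> \<beta> where \<alpha>: "\<alpha> \<ge> m" and \<beta>: "\<beta> \<ge> m"
    and ab: "b \<notin> supp x \<Longrightarrow> b \<notin> supp y \<Longrightarrow> K (rpt b) + \<alpha> * H y (rpt b) - \<beta> * H x (rpt b) = 0"
  proof (cases "b \<notin> supp x \<and> b \<notin> supp y")
    case True
    then have Hx: "H x (rpt b) \<ge> 1" and Hy: "H y (rpt b) \<ge> 1" using H1 b by auto
    \<comment> \<open>\<open>\<beta>\<close> is solved from the condition of a zero at
      \<open>b\<close>. In \<open>\<alpha>\<close> the summand \<open>m\<close> outweighs
      \<open>K\<close>, and \<open>m * H x (rpt b)\<close> then forces
      \<open>\<beta> \<ge> m\<close>.\<close>
    define \<alpha> where "\<alpha> = m + m * H x (rpt b)"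
    define \<beta> where "\<beta> = (K (rpt b) + \<alpha> * H y (rpt b)) / H x (rpt b)"
    have am: "\<alpha> \<ge> m" using m0 Hx by (simp add: \<alpha>_def)
    have "\<alpha> * 1 \<le> \<alpha> * H y (rpt b)" using am m0 Hy by (intro mult_left_mono) auto
    then have "K (rpt b) + \<alpha> * H y (rpt b) \<ge> m * H x (rpt b)"
      using mK[OF b] by (simp add: \<alpha>_def abs_less_iff)
    then have "\<beta> \<ge> m" using Hx by (simp add: \<beta>_def pos_le_divide_eq)
    moreover have "K (rpt b) + \<alpha> * H y (rpt b) - \<beta> * H x (rpt b) = 0"
      using Hx by (simp add: \<beta>_def)
    ultimately show thesis using that am by blast
  next
    case False
    then show thesis using that[of m m] by auto
  qed
  define d where "d e = ln (hval e x) - ln (hval e y) + (if hval e y = 0 then \<alpha> else 0)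
      - (if hval e x = 0 then \<beta> else 0)" for e
  define n where "n = (\<Sum>e\<in>E. d e *\<^sub>R hgrad e)"
  define k where "k = (\<Sum>e\<in>E. d e * of_int (snd (snd e))) + c"
  have L: "n \<bullet> z + k = K z + \<alpha> * H y z - \<beta> * H x z" for z
  proof -
    have "n \<bullet> z + k = (\<Sum>e\<in>E. d e * hval e z) + c"
      by (simp add: n_def k_def inner_sum_left hval_eq_inner distrib_left sum.distrib)
    also have "(\<Sum>e\<in>E. d e * hval e z) = (\<Sum>e\<in>E. ln (hval e x) * hval e z - ln (hval e y) * hval e z
        + \<alpha> * (if hval e y = 0 then hval e z else 0) - \<beta> * (if hval e x = 0 then hval e z else 0))"
      by (intro sum.cong refl) (simp add: d_def algebra_simps)
    finally show ?thesis
      by (simp add: K_def log_form_def H_def sum.distrib sum_subtractf sum_distrib_left)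
  qed
  show thesis
  proof (rule that[of n k])
    show "n \<noteq> 0"
    proof
      assume "n = 0"
      \<comment> \<open>Each term is nonnegative: \<open>d e\<close> has the sign of the difference
        by monotonicity of \<open>ln\<close> if both values are positive, and through the large
        \<open>\<alpha>\<close> or \<open>\<beta>\<close> if exactly one is zero. A zero sum thus
        forces equal edge values at \<open>x\<close> and \<open>y\<close>.\<close>
      then have "(\<Sum>e\<in>E. d e * (hval e x - hval e y)) = 0"
        by (metis (no_types, lifting) hval_diff inner_scaleR_left inner_sum_left inner_zero_left n_def sum.cong)
      moreover have nn: "d e * (hval e x - hval e y) \<ge> 0 \<and>
          (d e * (hval e x - hval e y) = 0 \<longrightarrow> hval e x = hval e y)" if e: "e \<in> E" for e
      proof -
        consider "hval e x = 0" "hval e y = 0" | "hval e x > 0" "hval e y = 0"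
          | "hval e x = 0" "hval e y > 0" | "hval e x > 0" "hval e y > 0"
          using hval_nonneg[OF e x] hval_nonneg[OF e y] by linarith
        then show ?thesis
        proof cases
          case 1 then show ?thesis by simp
        next
          case 2
          then have "d e > 0" using mx[OF e] \<alpha> by (simp add: d_def abs_less_iff)
          then show ?thesis using 2 by simp
        next
          case 3
          then have "d e < 0" using my[OF e] \<beta> by (simp add: d_def abs_less_iff)
          then show ?thesis using 3 by (simp add: mult_nonpos_nonneg)
        next
          case 4
          then have d: "d e = ln (hval e x) - ln (hval e y)" by (simp add: d_def)
          consider "hval e x = hval e y" | "hval e x < hval e y" | "hval e x > hval e y" by linarith
          then show ?thesis
          proof cases
            case 1 then show ?thesis by simp
          next
            case 2
            then have "d e < 0" using 4 by (simp add: d)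
            then show ?thesis using 2 by (simp add: mult_nonpos_nonpos)
          next
            case 3
            then have "d e > 0" using 4 by (simp add: d)
            then show ?thesis using 3 by simp
          qed
        qed
      qed
      ultimately have "\<forall>e\<in>E. d e * (hval e x - hval e y) = 0"
        using sum_nonneg_eq_0_iff[OF finite_edge_ineqs, of "\<lambda>e. d e * (hval e x - hval e y)"] by blast
      then have "\<And>e. e \<in> E \<Longrightarrow> hval e x = hval e y" using nn by blast
      then show False using hval_determines_point[OF x] ne by blast
    qed
    fix p
    {
      assume "p \<in> supp x" "p \<in> supp y"
      then show "n \<bullet> rpt p + k = log_form x (rpt p) - log_form y (rpt p) + c"
        by (simp add: L H0 K_def)
    next
      assume p: "p \<in> supp x" "p \<notin> supp y"
      then have pA: "p \<in> A" by (simp add: supp_iff)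
      have "m * 1 \<le> \<alpha> * H y (rpt p)"
        using \<alpha> m0 H1[OF pA p(2)] by (intro mult_mono) auto
      then show "n \<bullet> rpt p + k > 0" using mK[OF pA] p(1) by (simp add: L H0 abs_less_iff)
    next
      assume p: "p \<in> supp y" "p \<notin> supp x"
      then have pA: "p \<in> A" by (simp add: supp_iff)
      have "m * 1 \<le> \<beta> * H x (rpt p)"
        using \<beta> m0 H1[OF pA p(2)] by (intro mult_mono) auto
      then show "n \<bullet> rpt p + k < 0" using mK[OF pA] p(1) by (simp add: L H0 abs_less_iff)
    }
  next
    assume "b \<notin> supp x" "b \<notin> supp y"
    then show "n \<bullet> rpt b + k = 0" using ab by (simp add: L)
  qed
qed


section \<open>Compatibility implies injectivity\<close>

text \<open>The difference \<open>\<delta>\<close> of the normalised weights has zero sum and zero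
  moment against \<open>f\<close>. It has the sign of the separating form on the supports, so the
  quotients are positive weights with a kernel form, and the common sign makes each product
  vanish.\<close>

lemma collision_dets_eq_0:
  fixes f :: "int \<times> int \<Rightarrow> real \<times> real"
  assumes w: "\<And>p. p \<in> A \<Longrightarrow> w p > 0" and x: "x \<in> Delta A" and y: "y \<in> Delta A" and ne: "x \<noteq> y"
    and eq: "toric_patch A w f x = toric_patch A w f y"
    and same: "same_sign_dets A f" and b: "b \<in> A"
    and t: "t0 \<in> supp x \<union> supp y \<union> {b}" "t1 \<in> supp x \<union> supp y \<union> {b}" "t2 \<in> supp x \<union> supp y \<union> {b}"
  shows "det3 (rpt t0) (rpt t1) (rpt t2) * det3 (f t0) (f t1) (f t2) = 0"
proof -
  define Z where "Z z = (\<Sum>p\<in>A. w p * toric_bernstein A p z)" for z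
  define P where "P z p = w p * toric_bernstein A p z / Z z" for z p
  have Zpos: "Z x > 0" "Z y > 0"
    using patch_denominator_pos[of _ w] w x y unfolding Z_def by auto
  have sumP: "(\<Sum>p\<in>A. P z p) = 1" if "Z z > 0" for z
    using that by (simp add: P_def Z_def sum_divide_distrib[symmetric])
  have patch: "toric_patch A w f z = (\<Sum>p\<in>A. P z p *\<^sub>R f p)" for z
    by (simp add: toric_patch_def P_def Z_def scaleR_sum_right)
  have P0: "P z p = 0" if "z \<in> Delta A" "p \<in> A" "p \<notin> supp z" for z p
    using that by (simp add: P_def bernstein_eq)
  have Ppos: "P z p > 0" if "z \<in> {x, y}" "p \<in> supp z" for z p
    using that x y w[of p] Zpos by (auto simp: P_def bernstein_eq supp_iff)
  define \<delta> where "\<delta> p = P x p - P y p" for p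
  have s0: "(\<Sum>p\<in>A. \<delta> p) = 0" using sumP Zpos by (simp add: \<delta>_def sum_subtractf)
  have s1: "(\<Sum>p\<in>A. \<delta> p *\<^sub>R f p) = 0"
    using eq by (simp add: \<delta>_def patch scaleR_diff_left sum_subtractf)
  \<comment> \<open>With this constant the form is \<open>ln (P x p / P y p)\<close> on the common
    support.\<close>
  obtain n k where n: "n \<noteq> 0" and
    Lboth: "\<And>p. p \<in> supp x \<Longrightarrow> p \<in> supp y \<Longrightarrow>
      n \<bullet> rpt p + k = log_form x (rpt p) - log_form y (rpt p) + (ln (Z y) - ln (Z x))"
    and Lx: "\<And>p. p \<in> supp x \<Longrightarrow> p \<notin> supp y \<Longrightarrow> n \<bullet> rpt p + k > 0"
    and Ly: "\<And>p. p \<in> supp y \<Longrightarrow> p \<notin> supp x \<Longrightarrow> n \<bullet> rpt p + k < 0"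
    and Lb: "b \<notin> supp x \<Longrightarrow> b \<notin> supp y \<Longrightarrow> n \<bullet> rpt b + k = 0"
    by (rule separating_affine_form[OF x y ne b, where c = "ln (Z y) - ln (Z x)"]) (rule that)
  let ?L = "\<lambda>p. n \<bullet> rpt p + k"
  have sub: "supp x \<subseteq> A" "supp y \<subseteq> A" by (auto simp: supp_iff)
  have sgn: "sgn (\<delta> p) = sgn (?L p)" if p: "p \<in> supp x \<union> supp y" for p
  proof -
    consider "p \<in> supp x" "p \<in> supp y" | "p \<in> supp x" "p \<notin> supp y" | "p \<notin> supp x" "p \<in> supp y"
      using p by blast
    then show ?thesis
    proof cases
      case 1
      then have pA: "p \<in> A" using sub by blast
      have "P y p * exp (?L p) = w p * (exp (log_form y (rpt p)) * exp (?L p)) / Z y"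
        using 1 y pA by (simp add: P_def bernstein_eq)
      also have "exp (log_form y (rpt p)) * exp (?L p)
          = exp (log_form x (rpt p)) * (exp (ln (Z y)) / exp (ln (Z x)))"
        unfolding Lboth[OF 1] exp_add[symmetric] exp_diff[symmetric] by (simp add: algebra_simps)
      also have "w p * (exp (log_form x (rpt p)) * (exp (ln (Z y)) / exp (ln (Z x)))) / Z y = P x p"
        using 1 x pA Zpos by (simp add: P_def bernstein_eq)
      finally have "\<delta> p = P y p * (exp (?L p) - 1)" by (simp add: \<delta>_def algebra_simps)
      moreover have "sgn (exp (?L p) - 1) = sgn (?L p)" by (simp add: sgn_if)
      moreover have "sgn (P y p) = 1" using Ppos[of y p] 1 by simp
      ultimately show ?thesis by (simp add: sgn_mult)
    next
      case 2
      then have "\<delta> p > 0" using Ppos[of x p] P0[OF y, of p] sub by (auto simp: \<delta>_def)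
      then show ?thesis using Lx[OF 2] by simp
    next
      case 3
      then have "\<delta> p < 0" using Ppos[of y p] P0[OF x, of p] sub by (auto simp: \<delta>_def)
      then show ?thesis using Ly[OF 3(2,1)] by simp
    qed
  qed
  have \<delta>0: "\<delta> p = 0" if "p \<in> A" "p \<notin> supp x" "p \<notin> supp y" for p
    using that P0 x y by (simp add: \<delta>_def)
  \<comment> \<open>Where the form vanishes so does \<open>\<delta>\<close>, and any positive value
    serves; this admits \<open>b\<close> even off both supports.\<close>
  define r where "r p = (if p \<in> supp x \<union> supp y \<union> {b} then if ?L p = 0 then 1 else \<delta> p / ?L p else 0)" for p
  have rL: "r p * ?L p = \<delta> p" if "p \<in> A" for p
  proof (cases "p \<in> supp x \<union> supp y")
    case True
    show ?thesis
    proof (cases "?L p = 0")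
      case z: True
      then show ?thesis using sgn[OF True] by (simp add: sgn_zero_iff)
    next
      case False
      then show ?thesis using True by (simp add: r_def)
    qed
  next
    case False
    then show ?thesis using \<delta>0[OF that] Lb by (auto simp: r_def)
  qed
  have rpos: "r p > 0" if p: "p \<in> supp x \<union> supp y \<union> {b}" for p
  proof (cases "?L p = 0")
    case True
    then show ?thesis using p by (simp add: r_def)
  next
    case False
    then have p': "p \<in> supp x \<union> supp y" using p Lb by blast
    have "\<delta> p / ?L p > 0"
      using sgn[OF p'] False by (auto simp: sgn_if zero_less_divide_iff split: if_splits)
    then show ?thesis using False p by (simp add: r_def)
  qed
  have r0: "r p \<ge> 0" for p
    using rpos[of p] by (cases "p \<in> supp x \<union> supp y \<union> {b}") (auto simp: r_def)
  have "weighted_dets A r rpt f = 0"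
  proof (rule weighted_dets_eq_0[of n k])
    show "n \<noteq> 0 \<or> k \<noteq> 0" using n by simp
    show "(\<Sum>i\<in>A. r i * ?L i) = 0" using s0 rL by (simp cong: sum.cong)
    show "(\<Sum>i\<in>A. (r i * ?L i) *\<^sub>R f i) = 0" using s1 rL by (simp cong: sum.cong)
  qed
  moreover obtain s where "s \<in> {1, -1}"
    "\<And>a b c. a \<in> A \<Longrightarrow> b \<in> A \<Longrightarrow> c \<in> A \<Longrightarrow>
       s * (det3 (rpt a) (rpt b) (rpt c) * det3 (f a) (f b) (f c)) \<ge> 0"
    using same unfolding same_sign_dets_def by blast
  moreover have "t0 \<in> A" "t1 \<in> A" "t2 \<in> A" using t sub b by auto
  ultimately show ?thesis
    using weighted_dets_zero_terms[OF finA, of r rpt f s t0 t1 t2] r0 rpos t by blast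
qed

lemma singleton_supp_vertex:
  assumes x: "x \<in> Delta A" and s: "supp x = {a}"
  shows "x = rpt a" "rpt a extreme_point_of Delta A"
proof -
  show xa: "x = rpt a" using in_hull_supp[OF x] s by simp
  have "carrier_face x = {rpt a}" using carrier_face_eq_hull[of x] s by simp
  then show "rpt a extreme_point_of Delta A"
    using carrier_face_face[of x] by (simp add: face_of_singleton)
qed

lemma patch_at_singleton_supp:
  fixes f :: "int \<times> int \<Rightarrow> 'v::real_vector"
  assumes w: "\<And>p. p \<in> A \<Longrightarrow> w p > 0" and x: "x \<in> Delta A" and s: "supp x = {a}"
  shows "toric_patch A w f x = f a"
proof -
  have a: "a \<in> A" using s by (auto simp: supp_iff)
  let ?B = "w a * toric_bernstein A a x"
  have B: "?B > 0" using w[OF a] bernstein_pos_iff[OF x a] s by simp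
  have z: "w p * toric_bernstein A p x = 0" if "p \<in> A - {a}" for p
    using that x s by (simp add: bernstein_eq)
  have "(\<Sum>p\<in>A. w p * toric_bernstein A p x) = ?B"
    using sum.remove[OF finA a, of "\<lambda>p. w p * toric_bernstein A p x"] sum.neutral[of "A - {a}", OF ballI[OF z]]
    by simp
  moreover have "(\<Sum>p\<in>A. (w p * toric_bernstein A p x) *\<^sub>R f p) = ?B *\<^sub>R f a"
    using sum.remove[OF finA a, of "\<lambda>p. (w p * toric_bernstein A p x) *\<^sub>R f p"] z
    by (simp add: sum.neutral)
  ultimately show ?thesis using B by (auto simp: toric_patch_def)
qed

text \<open>The carrier face is the hull of its extreme points, so two points on it force two
  extreme points, and these are vertices of the polygon.\<close>

lemma two_vertices_in_supp:
  assumes "a \<in> supp x" "a' \<in> supp x" "a \<noteq> a'"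
  obtains v0 v1 where "v0 \<in> supp x" "v1 \<in> supp x" "v0 \<noteq> v1"
    "rpt v0 extreme_point_of Delta A" "rpt v1 extreme_point_of Delta A"
proof -
  let ?G = "carrier_face x"
  let ?X = "{z. z extreme_point_of ?G}"
  have G: "?G face_of Delta A" by (rule carrier_face_face)
  have "?G = convex hull ?X"
    by (rule Krein_Milman_Minkowski)
      (use face_of_imp_compact[OF convex_Delta compact_Delta G] face_of_imp_convex[OF G] in auto)
  moreover have "rpt a \<in> ?G" "rpt a' \<in> ?G" "rpt a \<noteq> rpt a'"
    using assms by (auto simp: supp_def inj_eq[OF inj_rpt])
  ultimately have "\<not> (\<exists>z. ?X \<subseteq> {z})"
    by (metis convex_hull_empty convex_hull_singleton empty_iff singletonD subset_singletonD)
  moreover have XG: "z \<in> ?G \<and> z extreme_point_of Delta A" if "z \<in> ?X" for z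
    using that extreme_point_of_face[OF G] by auto
  have lift: "\<exists>v\<in>supp x. z = rpt v" if "z \<in> ?X" for z
  proof -
    have "z \<in> rpt ` A"
      using extreme_point_of_convex_hull[of z "rpt ` A"] XG[OF that] by (simp add: Delta_def)
    then show ?thesis using XG[OF that] by (auto simp: supp_def)
  qed
  moreover have "?X \<noteq> {}" using calculation(1) by blast
  ultimately obtain z z' where z: "z \<in> ?X" "z' \<in> ?X" "z \<noteq> z'" by blast
  then obtain v v' where "v \<in> supp x" "v' \<in> supp x" "z = rpt v" "z' = rpt v'"
    using lift by metis
  then show thesis using that[of v v'] z XG by auto
qed

text \<open>Some edge form vanishes at \<open>a\<close> and \<open>a'\<close> but not at
  \<open>b\<close>, so \<open>b\<close> is off their line.\<close>

lemma det3_edge_nonzero: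
  assumes "a \<in> supp x" "a' \<in> supp x" "a \<noteq> a'" "b \<in> A" "b \<notin> supp x"
  shows "det3 (rpt a) (rpt a') (rpt b) \<noteq> 0"
proof
  assume d: "det3 (rpt a) (rpt a') (rpt b) = 0"
  obtain e where e: "e \<in> E" "hval e x = 0" "hint e b \<noteq> 0"
    using assms(4,5) by (auto simp: supp_iff)
  have h: "hval e (rpt a) = 0" "hval e (rpt a') = 0" "hval e (rpt b) \<noteq> 0"
    using assms(1,2) e by (auto simp: supp_iff hval_rpt)
  have "collinear {rpt a, rpt b, rpt a'}"
    using d aff_indep3_iff[of "rpt a" "rpt a'" "rpt b"]
    by (auto simp: aff_indep3_def collinear_3_eq_affine_dependent insert_commute)
  then obtain u where "rpt b = u *\<^sub>R rpt a + (1 - u) *\<^sub>R rpt a'"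
    using assms(3) by (auto simp: collinear_3_expand inj_eq[OF inj_rpt])
  then have "hval e (rpt b) = u * hval e (rpt a) + (1 - u) * hval e (rpt a')"
    using hval_convex_comb[of e "1 - u" "rpt a" "rpt a'"] by simp
  with h show False by simp
qed

text \<open>The support lies on an edge. Two of its points and an index \<open>b\<close> off it are
  not collinear, so by \<open>D\<close> their images are. Two vertices on the edge have distinct
  images, and the line through these catches all of \<open>f\<close>.\<close>

lemma small_supp_no_collision:
  fixes f :: "int \<times> int \<Rightarrow> real \<times> real"
  assumes vert: "\<And>u v. u \<in> A \<Longrightarrow> v \<in> A \<Longrightarrow> rpt u extreme_point_of Delta A \<Longrightarrow>
      rpt v extreme_point_of Delta A \<Longrightarrow> u \<noteq> v \<Longrightarrow> f u \<noteq> f v"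
    and ne: "supp x \<noteq> A" "a \<in> supp x" "a' \<in> supp x" "a \<noteq> a'"
    and D: "\<And>b t0 t1 t2. b \<in> A \<Longrightarrow> t0 \<in> supp x \<union> {b} \<Longrightarrow> t1 \<in> supp x \<union> {b} \<Longrightarrow> t2 \<in> supp x \<union> {b} \<Longrightarrow>
      det3 (rpt t0) (rpt t1) (rpt t2) * det3 (f t0) (f t1) (f t2) = 0"
    and t: "t0 \<in> A" "t1 \<in> A" "t2 \<in> A"
  shows "det3 (f t0) (f t1) (f t2) = 0"
proof -
  have sub: "supp x \<subseteq> A" by (auto simp: supp_iff)
  obtain v0 v1 where v: "v0 \<in> supp x" "v1 \<in> supp x" "v0 \<noteq> v1"
    "rpt v0 extreme_point_of Delta A" "rpt v1 extreme_point_of Delta A"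
    using two_vertices_in_supp[OF ne(2-4)] by blast
  have fv: "f v0 \<noteq> f v1" using vert v sub by blast
  have coll: "det3 (f c) (f c') (f b) = 0" if "c \<in> supp x" "c' \<in> supp x" "b \<in> A" "b \<notin> supp x" for c c' b
    using D[of b c c' b] det3_edge_nonzero[of c x c' b] that by (cases "c = c'") auto
  obtain b0 where b0: "b0 \<in> A" "b0 \<notin> supp x" using ne(1) sub by blast
  have on_line: "det3 (f v0) (f v1) (f c) = 0" if c: "c \<in> A" for c
  proof (cases "c \<in> supp x")
    case False
    then show ?thesis using coll v c by blast
  next
    case True
    have b: "det3 (f v0) (f v1) (f b0) = 0" using coll v b0 by blast
    show ?thesis
    \<comment> \<open>\<open>f b0\<close> differs from at least one of the distinct points
      \<open>f v0\<close> and \<open>f v1\<close>; the line joining it to that point contains the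
      other one and \<open>f c\<close>.\<close>
    proof (cases "f b0 = f v0")
      case False
      have "det3 (f v0) (f b0) (f v1) = 0" "det3 (f v0) (f b0) (f c) = 0"
        using b coll[OF v(1) True b0] det3_swap[of "f v0" "f b0"] by auto
      then show ?thesis using False det3_trans[of "f v0" "f b0" "f v0" "f v1" "f c"] by auto
    next
      case eq: True
      have "det3 (f v1) (f b0) (f v0) = 0" "det3 (f v1) (f b0) (f c) = 0"
        using eq coll[OF v(2) True b0] det3_swap[of "f v1" "f b0"] by auto
      then show ?thesis using eq fv det3_trans[of "f v1" "f b0" "f v0" "f v1" "f c"] by auto
    qed
  qed
  show ?thesis using det3_trans[OF fv on_line on_line on_line] t by blast
qed

text \<open>A full support contradicts the nonzero product, and a proper one with two indices is
  excluded by \<open>small_supp_no_collision\<close>. So \<open>x\<close> and \<open>y\<close> are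
  vertices, where the patch takes the distinct values \<open>f a\<close> and
  \<open>f b\<close>.\<close>

lemma compatible_imp_inj:
  fixes f :: "int \<times> int \<Rightarrow> real \<times> real"
  assumes comp: "compatible A f" and w: "\<And>p. p \<in> A \<Longrightarrow> w p > 0"
  shows "inj_on (toric_patch A w f) (Delta A)"
proof (rule inj_onI, rule ccontr)
  fix x y assume x: "x \<in> Delta A" and y: "y \<in> Delta A"
    and eq: "toric_patch A w f x = toric_patch A w f y" and ne: "x \<noteq> y"
  have same: "same_sign_dets A f"
    and vert: "\<And>u v. u \<in> A \<Longrightarrow> v \<in> A \<Longrightarrow> rpt u extreme_point_of Delta A \<Longrightarrow>
      rpt v extreme_point_of Delta A \<Longrightarrow> u \<noteq> v \<Longrightarrow> f u \<noteq> f v"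
    using comp by (auto simp: compatible_def weakly_compatible_iff_same_sign)
  obtain t0 t1 t2 where t: "t0 \<in> A" "t1 \<in> A" "t2 \<in> A"
    and Dt: "det3 (rpt t0) (rpt t1) (rpt t2) * det3 (f t0) (f t1) (f t2) \<noteq> 0"
    using same unfolding same_sign_dets_def by blast
  note D = collision_dets_eq_0[OF w x y ne eq same]
  have sub: "supp x \<subseteq> A" "supp y \<subseteq> A" by (auto simp: supp_iff)
  have big: False if z: "z \<in> {x, y}" and a: "a \<in> supp z" "a' \<in> supp z" "a \<noteq> a'" for z a a'
  proof (cases "supp z = A")
    case True
    then have "supp x \<union> supp y = A" using z sub by auto
    then show False using D[of t0 t0 t1 t2] t Dt by blast
  next
    case False
    have "det3 (rpt s0) (rpt s1) (rpt s2) * det3 (f s0) (f s1) (f s2) = 0"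
      if "b \<in> A" "s0 \<in> supp z \<union> {b}" "s1 \<in> supp z \<union> {b}" "s2 \<in> supp z \<union> {b}" for b s0 s1 s2
      by (rule D[of b]) (use that z in auto)
    from small_supp_no_collision[OF vert False a this t]
    have "det3 (f t0) (f t1) (f t2) = 0" .
    then show False using Dt by simp
  qed
  obtain a b where a: "a \<in> supp x" and b: "b \<in> supp y"
    using supp_nonempty x y by blast
  have sx: "supp x = {a}" using a big[of x a] by blast
  have sy: "supp y = {b}" using b big[of y b] by blast
  have ext: "rpt a extreme_point_of Delta A" "rpt b extreme_point_of Delta A" "x = rpt a" "y = rpt b"
    using singleton_supp_vertex x y sx sy by auto
  have corner: "toric_patch A w f z = f c" if z: "z \<in> Delta A" and s: "supp z = {c}" for z c
    by (rule patch_at_singleton_supp[OF w z s])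
  have "f a = f b" using eq corner[OF x sx] corner[OF y sy] by simp
  then show False using vert[of a b] ext ne a b sub by auto
qed


section \<open>Injectivity implies compatibility\<close>

definition log_grad :: "real \<times> real \<Rightarrow> real \<times> real" where
  "log_grad x = (\<Sum>e\<in>E. ln (hval e x) *\<^sub>R hgrad e)"

text \<open>\<open>log_grad\<close> is strictly monotone:
  \<open>(log_grad x - log_grad y) \<bullet> (x - y)\<close> is a sum of nonnegative terms that
  vanish only where the edge forms agree.\<close>

lemma log_grad_inj: "inj_on log_grad (interior (Delta A))"
proof (rule inj_onI)
  fix x y assume x: "x \<in> interior (Delta A)" and y: "y \<in> interior (Delta A)"
    and eq: "log_grad x = log_grad y"
  let ?t = "\<lambda>e. (ln (hval e x) - ln (hval e y)) * (hval e x - hval e y)"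
  have "(\<Sum>e\<in>E. ?t e) = (log_grad x - log_grad y) \<bullet> (x - y)"
    by (simp add: log_grad_def hval_diff inner_sum_left sum_subtractf[symmetric] scaleR_diff_left[symmetric])
  then have "(\<Sum>e\<in>E. ?t e) = 0" using eq by simp
  moreover have nn: "?t e \<ge> 0 \<and> (?t e = 0 \<longleftrightarrow> hval e x = hval e y)" if "e \<in> E" for e
    using ln_diff_mult_diff[of "hval e x" "hval e y"] hval_pos_interior[OF that] x y by blast
  ultimately have "\<forall>e\<in>E. ?t e = 0"
    using sum_nonneg_eq_0_iff[OF finite_edge_ineqs, of ?t] by blast
  then have "\<And>e. e \<in> E \<Longrightarrow> hval e x = hval e y" using nn by blast
  then show "x = y" using hval_determines_point x interior_subset by blast
qed

lemma open_log_grad_image: "open (log_grad ` interior (Delta A))"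
proof (rule invariance_of_domain[OF _ open_interior log_grad_inj])
  show "continuous_on (interior (Delta A)) log_grad"
    unfolding log_grad_def hval_eq_inner
    by (intro continuous_intros) (use hval_pos_interior in \<open>force simp: hval_eq_inner\<close>)
qed

lemma interior_Delta_nonempty: "interior (Delta A) \<noteq> {}"
  using rel_interior_interior[OF affine_hull_Delta] rel_interior_eq_empty[OF convex_Delta] dim2 by auto

lemma supp_interior:
  assumes "x \<in> interior (Delta A)"
  shows "supp x = A"
proof -
  have "hval e x \<noteq> 0" if "e \<in> E" for e
    using hval_pos_interior[OF that assms] by simp
  then show ?thesis unfolding set_eq_iff supp_iff by blast
qed

lemma log_form_diff_eq:
  assumes "log_grad x - log_grad y = v"
  obtains m where "\<And>z. log_form x z - log_form y z = v \<bullet> z + m"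
proof (rule that)
  fix z
  have "log_form x z = log_grad x \<bullet> z + (\<Sum>e\<in>E. ln (hval e x) * of_int (snd (snd e)))" for x
    unfolding log_form_def log_grad_def
    by (simp add: inner_sum_left sum.distrib[symmetric] hval_eq_inner[of _ z] distrib_left)
  then show "log_form x z - log_form y z = v \<bullet> z + ((\<Sum>e\<in>E. ln (hval e x) * of_int (snd (snd e)))
      - (\<Sum>e\<in>E. ln (hval e y) * of_int (snd (snd e))))"
    using assms by (auto simp: inner_diff_left)
qed

text \<open>Openness realises a small multiple of \<open>n\<close> as
  \<open>log_grad x - log_grad y\<close>. The weights make the weighted Bernstein values
  \<open>q p\<close> at \<open>y\<close> and \<open>exp m * (q p + r p * l p)\<close> at
  \<open>x\<close>; the extra term drops out of both sums by \<open>s0\<close> and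
  \<open>s1\<close>.\<close>

lemma collision_of_dependency:
  fixes f :: "int \<times> int \<Rightarrow> real \<times> real"
  assumes r: "\<And>p. p \<in> A \<Longrightarrow> r p > 0" and n: "n \<noteq> 0"
    and s0: "(\<Sum>p\<in>A. r p * (n \<bullet> rpt p + k)) = 0"
    and s1: "(\<Sum>p\<in>A. (r p * (n \<bullet> rpt p + k)) *\<^sub>R f p) = 0"
  obtains w where "\<And>p. p \<in> A \<Longrightarrow> w p > 0" "\<not> inj_on (toric_patch A w f) (Delta A)"
proof -
  obtain y where y: "y \<in> interior (Delta A)" using interior_Delta_nonempty by blast
  then obtain d where d: "d > 0" "ball (log_grad y) d \<subseteq> log_grad ` interior (Delta A)"
    using open_log_grad_image by (meson imageI open_contains_ball)
  define \<epsilon> where "\<epsilon> = d / (2 * norm n)"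
  have \<epsilon>: "\<epsilon> > 0" using d n by (simp add: \<epsilon>_def)
  have "log_grad y + \<epsilon> *\<^sub>R n \<in> ball (log_grad y) d"
    using d n by (simp add: dist_norm \<epsilon>_def)
  then obtain x where x: "x \<in> interior (Delta A)" "log_grad x = log_grad y + \<epsilon> *\<^sub>R n"
    using d(2) by (metis (no_types, lifting) imageE subsetD)
  have ne: "x \<noteq> y" using x(2) n \<epsilon> by auto
  have xD: "x \<in> Delta A" and yD: "y \<in> Delta A" using x y interior_subset by blast+
  obtain m0 where m0: "\<And>z. log_form x z - log_form y z = (\<epsilon> *\<^sub>R n) \<bullet> z + m0"
    using log_form_diff_eq[of x y "\<epsilon> *\<^sub>R n"] x(2) by auto
  define l where "l p = \<epsilon> * (n \<bullet> rpt p + k)" for p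
  \<comment> \<open>The constant left over after \<open>l p\<close>; it contributes the factor
    \<open>exp m\<close> to numerator and denominator alike.\<close>
  define m where "m = m0 - \<epsilon> * k"
  have lf: "log_form x (rpt p) = log_form y (rpt p) + l p + m" for p
    using m0[of "rpt p"] by (simp add: l_def m_def algebra_simps)
  \<comment> \<open>\<open>q\<close> solves \<open>q * (exp l - 1) = r * l\<close>\<close>
  define q where "q p = (if l p = 0 then r p else r p * l p / (exp (l p) - 1))" for p
  have q: "q p > 0" "q p * exp (l p) = q p + r p * l p" if "p \<in> A" for p
  proof -
    have "l p / (exp (l p) - 1) > 0" if "l p \<noteq> 0"
      using that by (cases "l p > 0") (auto simp: zero_less_divide_iff)
    then show "q p > 0" using r[OF that] by (auto simp: q_def simp flip: times_divide_eq_right)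
    show "q p * exp (l p) = q p + r p * l p" by (auto simp: q_def field_simps)
  qed
  define w where "w p = q p / toric_bernstein A p y" for p
  have by_: "toric_bernstein A p y = exp (log_form y (rpt p))" if "p \<in> A" for p
    using that bernstein_eq[OF yD] supp_interior[OF y] by simp
  have bx: "toric_bernstein A p x = exp (log_form y (rpt p)) * exp (l p) * exp m" if "p \<in> A" for p
    using that bernstein_eq[OF xD] supp_interior[OF x(1)] by (simp add: lf exp_add)
  have wy: "w p * toric_bernstein A p y = q p" if "p \<in> A" for p
    using by_[OF that] by (simp add: w_def)
  have wx: "w p * toric_bernstein A p x = exp m * (q p + \<epsilon> * (r p * (n \<bullet> rpt p + k)))" if "p \<in> A" for p
    using by_[OF that] bx[OF that] q(2)[OF that] by (simp add: w_def l_def mult_ac)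
  have "(\<Sum>p\<in>A. w p * toric_bernstein A p x)
      = exp m * ((\<Sum>p\<in>A. q p) + \<epsilon> * (\<Sum>p\<in>A. r p * (n \<bullet> rpt p + k)))"
    by (simp add: wx sum_distrib_left sum.distrib distrib_left cong: sum.cong)
  then have Zx: "(\<Sum>p\<in>A. w p * toric_bernstein A p x) = exp m * (\<Sum>p\<in>A. q p)" using s0 by simp
  have "(\<Sum>p\<in>A. (w p * toric_bernstein A p x) *\<^sub>R f p)
      = exp m *\<^sub>R ((\<Sum>p\<in>A. q p *\<^sub>R f p) + \<epsilon> *\<^sub>R (\<Sum>p\<in>A. (r p * (n \<bullet> rpt p + k)) *\<^sub>R f p))"
    by (simp add: wx scaleR_sum_right sum.distrib[symmetric] scaleR_add_left scaleR_add_right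
        distrib_left cong: sum.cong)
  then have Fx: "(\<Sum>p\<in>A. (w p * toric_bernstein A p x) *\<^sub>R f p) = exp m *\<^sub>R (\<Sum>p\<in>A. q p *\<^sub>R f p)"
    unfolding s1 by simp
  have "toric_patch A w f x = toric_patch A w f y"
    unfolding toric_patch_def Zx Fx by (simp add: wy cong: sum.cong)
  moreover have "w p > 0" if "p \<in> A" for p
    using q(1)[OF that] by_[OF that] by (simp add: w_def)
  ultimately show thesis using that[of w] ne xD yD by (auto simp: inj_on_def)
qed

text \<open>Failure of the sign condition yields positive weights with a singular moment matrix. Its
  kernel form is not constant, since the weights have positive sum, so it produces a
  collision.\<close>

lemma inj_imp_same_sign:
  fixes f :: "int \<times> int \<Rightarrow> real \<times> real"
  assumes inj: "\<And>w. (\<And>p. p \<in> A \<Longrightarrow> w p > 0) \<Longrightarrow> inj_on (toric_patch A w f) (Delta A)"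
  shows "same_sign_dets A f"
proof (rule ccontr)
  assume "\<not> same_sign_dets A f"
  then obtain r where r: "\<And>p. p \<in> A \<Longrightarrow> r p > 0" and "weighted_dets A r rpt f = 0"
    using weighted_dets_same_sign_or_zero[OF finA, of rpt f] unfolding same_sign_dets_def by blast
  then have "moment_det A r rpt f = 0" by (simp add: weighted_dets_eq_moment_det)
  then obtain n k where nk: "n \<noteq> 0 \<or> k \<noteq> 0"
    and s0: "(\<Sum>p\<in>A. r p * (n \<bullet> rpt p + k)) = 0"
    and s1: "(\<Sum>p\<in>A. (r p * (n \<bullet> rpt p + k)) *\<^sub>R f p) = 0"
    by (rule moment_det_eq_0D)
  have "A \<noteq> {}" using interior_Delta_nonempty by (auto simp: Delta_def)
  then have "(\<Sum>p\<in>A. r p) > 0" using finA r by (simp add: sum_pos)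
  then have "n \<noteq> 0" using nk s0 by (auto simp: sum_distrib_right[symmetric])
  from collision_of_dependency[OF r this s0 s1] inj show False by metis
qed

text \<open>At a vertex the patch equals the control point there, so injectivity for constant
  weights 1 separates the vertex images.\<close>

lemma inj_imp_compatible:
  fixes f :: "int \<times> int \<Rightarrow> real \<times> real"
  assumes inj: "\<And>w. (\<And>p. p \<in> A \<Longrightarrow> w p > 0) \<Longrightarrow> inj_on (toric_patch A w f) (Delta A)"
  shows "compatible A f"
  unfolding compatible_def weakly_compatible_iff_same_sign
proof (intro conjI ballI impI)
  show "same_sign_dets A f" by (rule inj_imp_same_sign[OF inj])
  fix u v assume uv: "u \<in> A" "v \<in> A"
    "rpt u extreme_point_of Delta A \<and> rpt v extreme_point_of Delta A \<and> u \<noteq> v"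
  have corner: "toric_patch A (\<lambda>_. 1) f (rpt p) = f p"
    if "p \<in> A" "rpt p extreme_point_of Delta A" for p
    using patch_at_singleton_supp[of "\<lambda>_. 1" "rpt p" p f] supp_vertex rpt_in_Delta that by simp
  show "f u \<noteq> f v"
  proof
    assume "f u = f v"
    then have "toric_patch A (\<lambda>_. 1) f (rpt u) = toric_patch A (\<lambda>_. 1) f (rpt v)"
      using corner uv by simp
    then have "rpt u = rpt v"
      using inj[of "\<lambda>_. 1"] uv rpt_in_Delta by (simp add: inj_on_def)
    then show False using uv by (simp add: inj_eq[OF inj_rpt])
  qed
qed

end

theorem theorem2:
  fixes A :: "(int \<times> int) set" and f :: "int \<times> int \<Rightarrow> real \<times> real"
  assumes "finite A" and "aff_dim (Delta A) = 2"
  shows "(\<forall>w. (\<forall>p\<in>A. w p > 0) \<longrightarrow> inj_on (toric_patch A w f) (Delta A)) \<longleftrightarrow> compatible A f"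
proof -
  interpret lattice_polygon A using assms by unfold_locales
  show ?thesis using compatible_imp_inj inj_imp_compatible by blast
qed

end
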